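(* Let $(X,T)$ be a topological dynamical system. (i) If $K\subseteq X$ is non-empty and compact, then $$h_{\rm top}^P(T,K)=\sup\{\overline{h}_\mu(T):\ \mu\in M(X),\ \mu(K)=1\}.$$ (ii) If $Z\subseteq X$ is analytic, then $$h_{\rm top}^P(T,Z)=\sup\{h_{\rm top}^P(T,K):\ K\subseteq Z \text{ is compact}\}.$$
   Context: A topological dynamical system (TDS) $(X,T)$ is a compact metric space $X$ with a continuous map $T:X\to X$. Fix a compatible metric $d$ on $X$. $M(X)$ is the set of all Borel probability measures on $X$. For $n\in\mathbb{N}=\{1,2,\dots\}$ let $d_n(x,y)=\max\{d(T^kx,T^ky):0\le k\le n-1\}$, $B_n(x,\epsilon)=\{y\in X: d_n(x,y)<\epsilon\}$ and $\overline{B}_n(x,\epsilon)=\{y\in X:d_n(x,y)\le\epsilon\}$. Measure-theoretical upper entropy of $\mu\in M(X)$: $\overline{h}_\mu(T)=\int \overline{h}_\mu(T,x)\,d\mu(x)$, where $\overline{h}_\mu(T,x)=\lim_{\epsilon\to0}\limsup_{n\to\infty}-\frac1n\log\mu(B_n(x,\epsilon))$ (values in $[0,\infty]$). Packing topological entropy: for $Z\subseteq X$, $s\ge0$, $N\in\mathbb{N}$, $\epsilon>0$, let $P^s_{N,\epsilon}(Z)=\sup\sum_i e^{-sn_i}$, the supremum over all finite or countable pairwise disjoint families $\{\overline{B}_{n_i}(x_i,\epsilon)\}$ with $x_i\in Z$ and $n_i\ge N$ for all $i$ (the empty family contributes $0$). Let $P^s_\epsilon(Z)=\lim_{N\to\infty}P^s_{N,\epsilon}(Z)$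 and $\mathcal{P}^s_\epsilon(Z)=\inf\{\sum_{i=1}^\infty P^s_\epsilon(Z_i):\bigcup_{i=1}^\infty Z_i\supseteq Z\}$. Let $h_{\rm top}^P(T,Z,\epsilon)\in[0,\infty]$ be the critical value of $s$ at which $\mathcal{P}^s_\epsilon(Z)$ jumps from $\infty$ to $0$, i.e. $\inf\{s\ge0:\mathcal{P}^s_\epsilon(Z)=0\}$ (with $\inf\emptyset=\infty$). It increases as $\epsilon$ decreases, and $h_{\rm top}^P(T,Z)=\lim_{\epsilon\to0}h_{\rm top}^P(T,Z,\epsilon)$. A set in a metric space is analytic if it is a continuous image of the space $\mathcal{N}$ of infinite sequences of natural numbers with its product topology. *)

theory Defs
  imports "HOL-Probability.Probability"
begin

text \<open>The compact metric space \<open>X\<close> is a type of class \<^class>\<open>metric_space\<close> with compact universe.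
  Entropies take values in \<^typ>\<open>ennreal\<close>, i.e. in \<open>[0, \<infinity>]\<close>.\<close>

text \<open>Only \<open>n \<ge> 1\<close> matters; truncated subtraction makes \<open>n = 0\<close> behave like \<open>n = 1\<close>.\<close>

definition bowen_dist :: "('a::metric_space \<Rightarrow> 'a) \<Rightarrow> nat \<Rightarrow> 'a \<Rightarrow> 'a \<Rightarrow> real" where
  "bowen_dist T n x y = (MAX k\<in>{0..n - 1}. dist ((T ^^ k) x) ((T ^^ k) y))"

definition bowen_ball :: "('a::metric_space \<Rightarrow> 'a) \<Rightarrow> nat \<Rightarrow> 'a \<Rightarrow> real \<Rightarrow> 'a set" where
  "bowen_ball T n x \<epsilon> = {y. bowen_dist T n x y < \<epsilon>}"

definition bowen_cball :: "('a::metric_space \<Rightarrow> 'a) \<Rightarrow> nat \<Rightarrow> 'a \<Rightarrow> real \<Rightarrow> 'a set" where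
  "bowen_cball T n x \<epsilon> = {y. bowen_dist T n x y \<le> \<epsilon>}"

definition borel_probs :: "'a::topological_space measure set" where
  "borel_probs = {\<mu>. sets \<mu> = sets borel \<and> prob_space \<mu>}"

text \<open>\<open>- log r\<close> for \<open>0 \<le> r \<le> 1\<close>, with \<open>- log 0 = \<infinity>\<close> (in HOL, \<open>ln 0 = 0\<close>).\<close>

definition neg_log :: "real \<Rightarrow> ennreal" where
  "neg_log r = (if r = 0 then \<infinity> else ennreal (- ln r))"

definition local_upper_entropy :: "('a::metric_space \<Rightarrow> 'a) \<Rightarrow> 'a measure \<Rightarrow> 'a \<Rightarrow> ennreal" where
  "local_upper_entropy T \<mu> x =
    Lim (at_right 0) (\<lambda>\<epsilon>. limsup (\<lambda>n. neg_log (measure \<mu> (bowen_ball T n x \<epsilon>)) / of_nat n))"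

definition upper_entropy :: "('a::metric_space \<Rightarrow> 'a) \<Rightarrow> 'a measure \<Rightarrow> ennreal" where
  "upper_entropy T \<mu> = (\<integral>\<^sup>+ x. local_upper_entropy T \<mu> x \<partial>\<mu>)"

text \<open>A finite or countable family is indexed by an arbitrary set \<open>I\<close> of natural numbers.\<close>

definition packing_pre :: "('a::metric_space \<Rightarrow> 'a) \<Rightarrow> real \<Rightarrow> nat \<Rightarrow> real \<Rightarrow> 'a set \<Rightarrow> ennreal" where
  "packing_pre T s N \<epsilon> Z =
    Sup {(\<Sum>\<^sub>\<infinity>i\<in>I. ennreal (exp (- s * real (n i)))) | (I :: nat set) (x :: nat \<Rightarrow> 'a) (n :: nat \<Rightarrow> nat).
      (\<forall>i\<in>I. x i \<in> Z \<and> N \<le> n i) \<and> disjoint_family_on (\<lambda>i. bowen_cball T (n i) (x i) \<epsilon>) I}"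

definition packing_lim :: "('a::metric_space \<Rightarrow> 'a) \<Rightarrow> real \<Rightarrow> real \<Rightarrow> 'a set \<Rightarrow> ennreal" where
  "packing_lim T s \<epsilon> Z = lim (\<lambda>N. packing_pre T s N \<epsilon> Z)"

definition packing_measure :: "('a::metric_space \<Rightarrow> 'a) \<Rightarrow> real \<Rightarrow> real \<Rightarrow> 'a set \<Rightarrow> ennreal" where
  "packing_measure T s \<epsilon> Z =
    Inf {(\<Sum>i. packing_lim T s \<epsilon> (W i)) | W :: nat \<Rightarrow> 'a set. Z \<subseteq> (\<Union>i. W i)}"

definition packing_entropy_at :: "('a::metric_space \<Rightarrow> 'a) \<Rightarrow> 'a set \<Rightarrow> real \<Rightarrow> ennreal" where
  "packing_entropy_at T Z \<epsilon> = Inf {ennreal s | s. 0 \<le> s \<and> packing_measure T s \<epsilon> Z = 0}"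

definition packing_entropy :: "('a::metric_space \<Rightarrow> 'a) \<Rightarrow> 'a set \<Rightarrow> ennreal" where
  "packing_entropy T Z = Lim (at_right 0) (packing_entropy_at T Z)"

text \<open>\<^typ>\<open>nat \<Rightarrow> nat\<close> carries the product topology of the discrete topology on \<^typ>\<open>nat\<close>.
  Being an image of a non-empty space, an analytic set in this sense is non-empty.\<close>

definition analytic_set :: "'a::metric_space set \<Rightarrow> bool" where
  "analytic_set Z \<longleftrightarrow> (\<exists>f :: (nat \<Rightarrow> nat) \<Rightarrow> 'a. continuous_on UNIV f \<and> range f = Z)"


subsection \<open>Existence of the limits in the definitions\<close>

lemma tendsto_SUP_at_right:
  fixes g :: "real \<Rightarrow> ennreal"
  assumes "\<And>a b. 0 < a \<Longrightarrow> a \<le> b \<Longrightarrow> g b \<le> g a"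
  shows "(g \<longlongrightarrow> (SUP \<epsilon>\<in>{0<..}. g \<epsilon>)) (at_right 0)"
proof (rule order_tendstoI)
  fix l assume "l < (SUP \<epsilon>\<in>{0<..}. g \<epsilon>)"
  then obtain e where e: "0 < e" "l < g e" by (auto simp: less_SUP_iff)
  have "\<forall>\<^sub>F \<epsilon> in at_right 0. \<epsilon> \<in> {0<..<e}"
    using e(1) by (rule eventually_at_right_real)
  then show "\<forall>\<^sub>F \<epsilon> in at_right 0. l < g \<epsilon>"
    by eventually_elim (use assms e(2) in \<open>auto intro: less_le_trans\<close>)
next
  fix u assume *: "(SUP \<epsilon>\<in>{0<..}. g \<epsilon>) < u"
  have "\<forall>\<^sub>F \<epsilon> in at_right (0::real). \<epsilon> \<in> {0<..<1}"
    by (rule eventually_at_right_real) simp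
  then show "\<forall>\<^sub>F \<epsilon> in at_right 0. g \<epsilon> < u"
    by eventually_elim (use * in \<open>auto intro: le_less_trans[OF SUP_upper]\<close>)
qed

lemma bowen_dist_le_iff: "bowen_dist T n x y \<le> r \<longleftrightarrow> (\<forall>k\<in>{0..n - 1}. dist ((T ^^ k) x) ((T ^^ k) y) \<le> r)"
  unfolding bowen_dist_def by (subst Max_le_iff) auto

lemma bowen_dist_less_iff: "bowen_dist T n x y < r \<longleftrightarrow> (\<forall>k\<in>{0..n - 1}. dist ((T ^^ k) x) ((T ^^ k) y) < r)"
  unfolding bowen_dist_def by (subst Max_less_iff) auto

lemma open_bowen_ball:
  assumes "continuous_on UNIV T"
  shows "open (bowen_ball T n x \<epsilon>)"
proof -
  have c: "continuous_on UNIV (T ^^ k)" for k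
    by (induction k) (auto intro!: continuous_on_compose2[OF assms] simp: id_def)
  have eq: "bowen_ball T n x \<epsilon> = (\<Inter>k\<in>{0..n - 1}. {y. dist ((T ^^ k) x) ((T ^^ k) y) < \<epsilon>})"
    by (auto simp: bowen_ball_def bowen_dist_less_iff)
  show ?thesis
    unfolding eq by (intro open_INT ballI open_Collect_less continuous_intros c) auto
qed

lemma neg_log_antimono: "0 \<le> a \<Longrightarrow> a \<le> b \<Longrightarrow> neg_log b \<le> neg_log a"
  by (auto simp: neg_log_def intro!: ennreal_leI)

lemma local_upper_entropy_tendsto:
  assumes "continuous_on UNIV T" "\<mu> \<in> borel_probs"
  shows "((\<lambda>\<epsilon>. limsup (\<lambda>n. neg_log (measure \<mu> (bowen_ball T n x \<epsilon>)) / of_nat n))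
    \<longlongrightarrow> local_upper_entropy T \<mu> x) (at_right 0)"
proof -
  interpret prob_space \<mu> using assms(2) by (simp add: borel_probs_def)
  let ?g = "\<lambda>\<epsilon>. limsup (\<lambda>n. neg_log (measure \<mu> (bowen_ball T n x \<epsilon>)) / of_nat n)"
  have "(?g \<longlongrightarrow> (SUP \<epsilon>\<in>{0<..}. ?g \<epsilon>)) (at_right 0)"
  proof (rule tendsto_SUP_at_right)
    fix a b :: real assume "a \<le> b"
    have m: "bowen_ball T n x r \<in> sets \<mu>" for n r
      using open_bowen_ball[OF assms(1)] assms(2) by (simp add: borel_probs_def)
    have "measure \<mu> (bowen_ball T n x a) \<le> measure \<mu> (bowen_ball T n x b)" for n
      by (rule finite_measure_mono[OF _ m]) (use \<open>a \<le> b\<close> in \<open>auto simp: bowen_ball_def\<close>)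
    then show "?g b \<le> ?g a"
      by (intro Limsup_mono always_eventually allI divide_right_mono_ennreal neg_log_antimono) auto
  qed
  then show ?thesis
    unfolding local_upper_entropy_def by (subst tendsto_Lim) auto
qed

lemma packing_pre_antimono_N: "M \<le> N \<Longrightarrow> packing_pre T s N \<epsilon> Z \<le> packing_pre T s M \<epsilon> Z"
  unfolding packing_pre_def by (rule Sup_subset_mono) (blast intro: order_trans)

lemma packing_pre_tendsto: "(\<lambda>N. packing_pre T s N \<epsilon> Z) \<longlonglongrightarrow> packing_lim T s \<epsilon> Z"
  and packing_lim_eq_INF: "packing_lim T s \<epsilon> Z = (INF N. packing_pre T s N \<epsilon> Z)"
proof -
  have *: "(\<lambda>N. packing_pre T s N \<epsilon> Z) \<longlonglongrightarrow> (INF N. packing_pre T s N \<epsilon> Z)"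
    by (rule LIMSEQ_INF) (simp add: decseq_def packing_pre_antimono_N)
  then show "packing_lim T s \<epsilon> Z = (INF N. packing_pre T s N \<epsilon> Z)"
    unfolding packing_lim_def by (rule limI)
  with * show "(\<lambda>N. packing_pre T s N \<epsilon> Z) \<longlonglongrightarrow> packing_lim T s \<epsilon> Z" by simp
qed

lemma packing_pre_antimono_eps: "a \<le> b \<Longrightarrow> packing_pre T s N b Z \<le> packing_pre T s N a Z"
proof -
  assume "a \<le> b"
  then have "bowen_cball T n x a \<subseteq> bowen_cball T n x b" for n and x :: 'a
    by (auto simp: bowen_cball_def)
  then have "disjoint_family_on (\<lambda>i. bowen_cball T (n i) (x i) a) I"
    if "disjoint_family_on (\<lambda>i. bowen_cball T (n i) (x i) b) I"
    for I :: "nat set" and n and x :: "nat \<Rightarrow> 'a"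
    using that unfolding disjoint_family_on_def by blast
  then show ?thesis
    unfolding packing_pre_def by (intro Sup_subset_mono) blast
qed

lemma packing_measure_antimono_eps: "a \<le> b \<Longrightarrow> packing_measure T s b Z \<le> packing_measure T s a Z"
proof -
  assume "a \<le> b"
  then have "packing_lim T s b W \<le> packing_lim T s a W" for W
    unfolding packing_lim_eq_INF by (intro INF_mono) (auto intro: packing_pre_antimono_eps)
  then have "(\<Sum>i. packing_lim T s b (W i)) \<le> (\<Sum>i. packing_lim T s a (W i))" for W :: "nat \<Rightarrow> 'a set"
    by (intro suminf_le) auto
  then show ?thesis
    unfolding packing_measure_def by (intro Inf_mono) blast
qed

lemma packing_entropy_at_antimono: "a \<le> b \<Longrightarrow> packing_entropy_at T Z b \<le> packing_entropy_at T Z a"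
proof -
  assume "a \<le> b"
  then have "packing_measure T s b Z = 0" if "packing_measure T s a Z = 0" for s
    using packing_measure_antimono_eps[of a b T s Z] that by simp
  then show ?thesis
    unfolding packing_entropy_at_def by (intro Inf_superset_mono) blast
qed

lemma packing_entropy_tendsto: "(packing_entropy_at T Z \<longlongrightarrow> packing_entropy T Z) (at_right 0)"
proof -
  have "(packing_entropy_at T Z \<longlongrightarrow> (SUP \<epsilon>\<in>{0<..}. packing_entropy_at T Z \<epsilon>)) (at_right 0)"
    by (rule tendsto_SUP_at_right) (rule packing_entropy_at_antimono)
  then show ?thesis
    unfolding packing_entropy_def by (subst tendsto_Lim) auto
qed

end

theory Submission
  imports Defs
begin

text \<open>
  Both claims follow from two facts about packing entropy.

  If \<open>\<mu>\<close> lives on \<open>Z\<close>, then its upper entropy is at most the packing entropy of \<open>Z\<close>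
  (\<open>upper_entropy_le_packing_entropy\<close>). A finite packing sum at scale \<open>\<epsilon> / 3\<close> limits the number of
  disjoint \<open>n\<close>-balls, hence the measure of the set of points whose \<open>n\<close>-balls are too small; by
  Borel--Cantelli, almost no point has too small balls infinitely often.

  Conversely, if \<open>Z\<close> is the continuous image under \<open>f\<close> of sequence space and \<open>c\<close> is less than its
  packing entropy, then some compact \<open>K \<subseteq> Z\<close> carries a probability measure of upper entropy greater
  than \<open>c\<close> (\<open>measure_with_large_upper_entropy\<close>). After removing all cylinders whose image is
  negligible, what is left of a cylinder is empty or has a non-negligible image, and such an
  image contains, for arbitrarily large \<open>n\<close>, at least \<open>exp (s n)\<close> points that are \<open>\<epsilon>\<close>-separated in
  \<open>d\<^sub>n\<close> (\<open>many_separated_points\<close>). Shrinking to small cylinders around these points and repeating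
  (\<open>separated_children\<close>) builds a finitely branching tree. Its branches form a relatively compact
  set of sequences, and the image of a random branch is the required measure: a node with at least
  \<open>exp (s n)\<close> separated children picks each of them with probability at most \<open>exp (- s n)\<close>, so
  around almost every point there are \<open>n\<close>-balls of measure at most \<open>exp (- s n)\<close> for infinitely
  many \<open>n\<close>. This is where the limit superior in the definition of upper entropy enters:
  nothing is known about the orders between two consecutive branching times.

  Claim (i) combines both facts with the analyticity of non-empty compact sets
  (\<open>compact_imp_analytic_set\<close>). For claim (ii), the packing entropy of the compact set \<open>K\<close> is at
  least the upper entropy of the measure it carries, hence greater than \<open>c\<close>.
\<close>

section \<open>Monotonicity of entropies and the Bowen metrics\<close>

lemma packing_entropy_eq_SUP: "packing_entropy T Z = (SUP \<epsilon>\<in>{0<..}. packing_entropy_at T Z \<epsilon>)"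
  unfolding packing_entropy_def
  by (intro tendsto_Lim tendsto_SUP_at_right packing_entropy_at_antimono) auto

lemma local_upper_entropy_eq_SUP:
  assumes "continuous_on UNIV T" "\<mu> \<in> borel_probs"
  shows "local_upper_entropy T \<mu> x =
    (SUP \<epsilon>\<in>{0<..}. limsup (\<lambda>n. neg_log (measure \<mu> (bowen_ball T n x \<epsilon>)) / of_nat n))"
proof -
  interpret prob_space \<mu> using assms(2) by (simp add: borel_probs_def)
  have ball: "bowen_ball T n x r \<in> sets \<mu>" for n r
    using open_bowen_ball[OF assms(1)] assms(2) by (simp add: borel_probs_def)
  have mono: "measure \<mu> (bowen_ball T n x a) \<le> measure \<mu> (bowen_ball T n x b)" if "a \<le> b" for n a b
    by (rule finite_measure_mono[OF _ ball]) (use that in \<open>auto simp: bowen_ball_def\<close>)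
  show ?thesis
    unfolding local_upper_entropy_def
    by (intro tendsto_Lim tendsto_SUP_at_right Limsup_mono always_eventually allI
        divide_right_mono_ennreal neg_log_antimono mono) auto
qed

lemma packing_entropy_mono:
  assumes "Y \<subseteq> Z"
  shows "packing_entropy T Y \<le> packing_entropy T Z"
proof -
  have "packing_measure T s \<epsilon> Y \<le> packing_measure T s \<epsilon> Z" for s \<epsilon>
    unfolding packing_measure_def by (intro Inf_superset_mono) (use assms in blast)
  then have "packing_measure T s \<epsilon> Z = 0 \<Longrightarrow> packing_measure T s \<epsilon> Y = 0" for s \<epsilon>
    by (metis le_zero_eq)
  then have "packing_entropy_at T Y \<epsilon> \<le> packing_entropy_at T Z \<epsilon>" for \<epsilon>
    unfolding packing_entropy_at_def by (intro Inf_superset_mono) blast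
  then show ?thesis
    unfolding packing_entropy_eq_SUP by (intro SUP_mono) auto
qed

lemma bowen_dist_self [simp]: "bowen_dist T n x x = 0"
  unfolding bowen_dist_def by simp

lemma bowen_dist_commute: "bowen_dist T n x y = bowen_dist T n y x"
  unfolding bowen_dist_def by (simp add: dist_commute)

lemma bowen_dist_mono: "m \<le> n \<Longrightarrow> bowen_dist T m x y \<le> bowen_dist T n x y"
  unfolding bowen_dist_def by (intro Max_mono image_mono) auto

lemma bowen_dist_triangle: "bowen_dist T n x z \<le> bowen_dist T n x y + bowen_dist T n y z"
proof -
  have le: "dist ((T ^^ k) u) ((T ^^ k) v) \<le> bowen_dist T n u v" if "k \<in> {0..n - 1}" for k u v
    using that unfolding bowen_dist_def by (intro Max_ge) auto
  show ?thesis
    unfolding bowen_dist_le_iff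
  proof
    fix k assume k: "k \<in> {0..n - 1}"
    have "dist ((T ^^ k) x) ((T ^^ k) z)
        \<le> dist ((T ^^ k) x) ((T ^^ k) y) + dist ((T ^^ k) y) ((T ^^ k) z)"
      by (rule dist_triangle)
    then show "dist ((T ^^ k) x) ((T ^^ k) z) \<le> bowen_dist T n x y + bowen_dist T n y z"
      using le[OF k, of x y] le[OF k, of y z] by linarith
  qed
qed

section \<open>Upper entropy of a measure is at most packing entropy\<close>

lemma packing_pre_ge_card:
  assumes "finite E" "E \<subseteq> W" "N \<le> n" "disjoint_family_on (\<lambda>x. bowen_cball T n x \<epsilon>) E"
  shows "ennreal (real (card E) * exp (- s * real n)) \<le> packing_pre T s N \<epsilon> W"
proof -
  obtain h where h: "bij_betw h {..<card E} E"
    using ex_bij_betw_nat_finite[OF assms(1)] by (auto simp: atLeast0LessThan)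
  let ?I = "{..<card E}"
  have "ennreal (real (card E) * exp (- s * real n)) = (\<Sum>\<^sub>\<infinity>i\<in>?I. ennreal (exp (- s * real n)))"
    by (simp add: ennreal_mult ennreal_of_nat_eq_real_of_nat)
  also have "\<dots> \<le> packing_pre T s N \<epsilon> W"
    unfolding packing_pre_def
  proof (rule Sup_upper, rule CollectI, intro exI conjI)
    show "(\<Sum>\<^sub>\<infinity>i\<in>?I. ennreal (exp (- s * real n))) = (\<Sum>\<^sub>\<infinity>i\<in>?I. ennreal (exp (- s * real ((\<lambda>_. n) i))))"
      by simp
    show "\<forall>i\<in>?I. h i \<in> W \<and> N \<le> n"
      using h assms(2,3) by (auto simp: bij_betw_def)
    show "disjoint_family_on (\<lambda>i. bowen_cball T n (h i) \<epsilon>) ?I"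
      using h assms(4) unfolding disjoint_family_on_def bij_betw_def inj_on_def by blast
  qed
  finally show ?thesis .
qed

text \<open>A disjoint family of \<open>\<epsilon> / 3\<close>-balls of the same order \<open>n\<close> that cannot be
  enlarged has centres at \<open>d\<^sub>n\<close>-distance at most \<open>2\<epsilon> / 3 < \<epsilon>\<close> from every point of \<open>E\<close>. The bound
  on the cardinality guarantees that such a family exists; it is what a finite packing sum
  provides.\<close>

lemma maximal_disjoint_balls:
  assumes "\<And>F. finite F \<Longrightarrow> F \<subseteq> E \<Longrightarrow> disjoint_family_on (\<lambda>x. bowen_cball T n x (\<epsilon> / 3)) F \<Longrightarrow>
      real (card F) \<le> C" and "0 < \<epsilon>"
  obtains F where "finite F" "F \<subseteq> E" "disjoint_family_on (\<lambda>x. bowen_cball T n x (\<epsilon> / 3)) F"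
    "E \<subseteq> (\<Union>x\<in>F. bowen_ball T n x \<epsilon>)"
proof -
  define ok where "ok F \<longleftrightarrow> finite F \<and> F \<subseteq> E \<and> disjoint_family_on (\<lambda>x. bowen_cball T n x (\<epsilon> / 3)) F"
    for F
  have "ok {}" by (simp add: ok_def disjoint_family_on_def)
  moreover have "card F \<le> nat \<lfloor>C\<rfloor>" if "ok F" for F
    using assms(1)[of F] that by (simp add: ok_def le_nat_floor)
  then have "\<forall>F. ok F \<longrightarrow> card F < Suc (nat \<lfloor>C\<rfloor>)" by (simp add: less_Suc_eq_le)
  ultimately obtain F where F: "ok F" and maxi: "\<And>G. ok G \<Longrightarrow> card G \<le> card F"
    using ex_has_greatest_nat[of ok "{}" card] by blast
  have "x \<in> (\<Union>y\<in>F. bowen_ball T n y \<epsilon>)" if x: "x \<in> E" for x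
  proof (cases "x \<in> F")
    case True
    then show ?thesis using assms(2) by (auto simp: bowen_ball_def intro!: bexI[of _ x])
  next
    case False
    have "\<not> ok (insert x F)"
      using maxi[of "insert x F"] False F by (auto simp: ok_def)
    then obtain y where y: "y \<in> F" "bowen_cball T n x (\<epsilon> / 3) \<inter> bowen_cball T n y (\<epsilon> / 3) \<noteq> {}"
      using F x False unfolding ok_def disjoint_family_on_insert[OF False] by auto
    then obtain z where z: "bowen_dist T n x z \<le> \<epsilon> / 3" "bowen_dist T n y z \<le> \<epsilon> / 3"
      by (auto simp: bowen_cball_def)
    have "bowen_dist T n y x < \<epsilon>"
      using bowen_dist_triangle[of T n y x z] z bowen_dist_commute[of T n x z] assms(2) by linarith
    then show ?thesis using y by (auto simp: bowen_ball_def)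
  qed
  then have "E \<subseteq> (\<Union>x\<in>F. bowen_ball T n x \<epsilon>)" by (rule subsetI)
  with F show thesis unfolding ok_def by (intro that) auto
qed

text \<open>Let \<open>E\<^sub>n\<close> be the set of points of \<open>W\<close> whose \<open>n\<close>-ball has measure less than
  \<open>exp (- (t + \<delta>) n)\<close>. A maximal disjoint family of \<open>\<epsilon> / 3\<close>-balls centred in \<open>E\<^sub>n\<close> has at most
  \<open>C exp (t n)\<close> members, where \<open>C\<close> is the finite packing sum, so the corresponding \<open>\<epsilon>\<close>-balls
  cover \<open>E\<^sub>n\<close> by an open set of measure at most \<open>C exp (- \<delta> n)\<close>. These bounds are summable, and
  the Borel--Cantelli lemma applies. Since the covering sets are open, \<open>W\<close> may be any set.\<close>

lemma AE_ball_measure_ge_of_packing_finite: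
  assumes T: "continuous_on UNIV T" and \<mu>: "\<mu> \<in> borel_probs" and "0 < \<epsilon>" "0 < \<delta>"
    and fin: "packing_pre T t N (\<epsilon> / 3) W < \<infinity>"
  shows "AE x in \<mu>. x \<in> W \<longrightarrow>
    (\<forall>\<^sub>F n in sequentially. exp (- (t + \<delta>) * real n) \<le> measure \<mu> (bowen_ball T n x \<epsilon>))"
proof -
  interpret prob_space \<mu> using \<mu> by (simp add: borel_probs_def)
  have sets_\<mu>: "sets \<mu> = sets borel" using \<mu> by (simp add: borel_probs_def)
  obtain C where C: "packing_pre T t N (\<epsilon> / 3) W = ennreal C" "0 \<le> C"
    using fin by (cases "packing_pre T t N (\<epsilon> / 3) W") auto
  define E where "E n = {x \<in> W. measure \<mu> (bowen_ball T n x \<epsilon>) < exp (- (t + \<delta>) * real n)}" for n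
  have "\<exists>U. open U \<and> E n \<subseteq> U \<and> measure \<mu> U \<le> C * exp (- \<delta>) ^ n" if n: "N \<le> n" for n
  proof -
    have card: "real (card F) \<le> C * exp (t * real n)"
      if "finite F" "F \<subseteq> E n" "disjoint_family_on (\<lambda>x. bowen_cball T n x (\<epsilon> / 3)) F" for F
    proof -
      have "ennreal (real (card F) * exp (- t * real n)) \<le> ennreal C"
        using packing_pre_ge_card[OF that(1) _ n that(3), of W t] that(2) C by (auto simp: E_def)
      then have "real (card F) * exp (- t * real n) \<le> C" using C by (simp add: ennreal_le_iff)
      then show ?thesis by (simp add: exp_minus field_simps)
    qed
    obtain F where F: "finite F" "F \<subseteq> E n" "disjoint_family_on (\<lambda>x. bowen_cball T n x (\<epsilon> / 3)) F"
      "E n \<subseteq> (\<Union>x\<in>F. bowen_ball T n x \<epsilon>)"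
      by (rule maximal_disjoint_balls[of "E n" T n \<epsilon>, OF card \<open>0 < \<epsilon>\<close>])
    let ?U = "\<Union>x\<in>F. bowen_ball T n x \<epsilon>"
    have "measure \<mu> ?U \<le> (\<Sum>x\<in>F. measure \<mu> (bowen_ball T n x \<epsilon>))"
      by (rule finite_measure_subadditive_finite[OF F(1)])
        (use open_bowen_ball[OF T] sets_\<mu> in auto)
    also have "\<dots> \<le> (\<Sum>x\<in>F. exp (- (t + \<delta>) * real n))"
      by (rule sum_mono) (use F(2) in \<open>auto simp: E_def\<close>)
    also have "\<dots> = real (card F) * exp (- (t + \<delta>) * real n)" by simp
    also have "\<dots> \<le> (C * exp (t * real n)) * exp (- (t + \<delta>) * real n)"
      by (rule mult_right_mono[OF card[OF F(1,2,3)]]) simp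
    also have "\<dots> = C * exp (t * real n + - (t + \<delta>) * real n)"
      by (simp only: exp_add mult.assoc)
    also have "t * real n + - (t + \<delta>) * real n = real n * - \<delta>"
      by (simp add: algebra_simps)
    also have "exp (real n * - \<delta>) = exp (- \<delta>) ^ n"
      by (rule exp_of_nat_mult)
    finally show ?thesis
      using F(4) open_bowen_ball[OF T] by (intro exI[of _ ?U]) auto
  qed
  then obtain U where U: "\<And>n. N \<le> n \<Longrightarrow> open (U n)" "\<And>n. N \<le> n \<Longrightarrow> E n \<subseteq> U n"
    "\<And>n. N \<le> n \<Longrightarrow> measure \<mu> (U n) \<le> C * exp (- \<delta>) ^ n"
    by metis
  \<comment> \<open>the covers exist only from order \<open>N\<close> on, so the sequence is shifted\<close>
  define A where "A n = U (n + N)" for n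
  have "AE x in \<mu>. \<forall>\<^sub>F n in sequentially. x \<in> space \<mu> - A n"
  proof (rule borel_cantelli_AE1)
    show "A n \<in> sets \<mu>" for n using U(1) sets_\<mu> by (simp add: A_def)
    show "emeasure \<mu> (A n) < \<infinity>" for n by (simp add: less_top[symmetric])
    have "summable (\<lambda>n. C * exp (- \<delta>) ^ n)"
      using \<open>0 < \<delta>\<close> by (intro summable_mult summable_geometric) simp
    then have "summable (\<lambda>n. C * exp (- \<delta>) ^ (n + N))"
      by (simp only: summable_iff_shift[where f = "\<lambda>n. C * exp (- \<delta>) ^ n"])
    then show "summable (\<lambda>n. measure \<mu> (A n))"
      by (rule summable_comparison_test') (use U(3) in \<open>auto simp: A_def\<close>)
  qed
  then show ?thesis
  proof eventually_elim
    case (elim x)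
    show ?case
    proof
      assume x: "x \<in> W"
      have "\<forall>\<^sub>F n in sequentially. x \<notin> U (n + N)"
        using elim by eventually_elim (simp add: A_def)
      then have "\<forall>\<^sub>F n in sequentially. x \<notin> U n"
        by (simp only: eventually_sequentially_seg[where P = "\<lambda>n. x \<notin> U n"])
      moreover have "\<forall>\<^sub>F n in sequentially. N \<le> n" by (rule eventually_ge_at_top)
      ultimately show "\<forall>\<^sub>F n in sequentially. exp (- (t + \<delta>) * real n) \<le> measure \<mu> (bowen_ball T n x \<epsilon>)"
      proof eventually_elim
        case (elim n)
        then have "x \<notin> E n" using U(2) by blast
        with x show ?case by (simp add: E_def not_less)
      qed
    qed
  qed
qed

lemma neg_log_over_le:
  assumes "exp (- a * real n) \<le> r" "r \<le> 1" "0 \<le> a" "1 \<le> n"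
  shows "neg_log r / of_nat n \<le> ennreal a"
proof -
  have r: "0 < r" using assms(1) by (rule less_le_trans[rotated]) simp
  then have "- a * real n \<le> ln r" using assms(1) by (simp add: ln_ge_iff)
  then have "- ln r / real n \<le> a" using assms(4) by (simp add: field_simps)
  moreover have "neg_log r / of_nat n = ennreal (- ln r / real n)"
    using r assms(2,4) by (simp add: neg_log_def ennreal_of_nat_eq_real_of_nat divide_ennreal)
  ultimately show ?thesis by (simp add: ennreal_leI)
qed

lemma AE_limsup_le_of_packing_measure_zero:
  assumes T: "continuous_on UNIV T" and \<mu>: "\<mu> \<in> borel_probs" and Z: "AE x in \<mu>. x \<in> Z"
    and "0 < \<epsilon>" "0 \<le> t" and zero: "packing_measure T t (\<epsilon> / 3) Z = 0"
  shows "AE x in \<mu>. limsup (\<lambda>n. neg_log (measure \<mu> (bowen_ball T n x \<epsilon>)) / of_nat n) \<le> ennreal t"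
proof -
  interpret prob_space \<mu> using \<mu> by (simp add: borel_probs_def)
  have "packing_measure T t (\<epsilon> / 3) Z < 1" by (simp add: zero)
  then obtain W :: "nat \<Rightarrow> 'a set" where W: "Z \<subseteq> (\<Union>i. W i)" "(\<Sum>i. packing_lim T t (\<epsilon> / 3) (W i)) < 1"
    unfolding packing_measure_def Inf_less_iff by blast
  have "\<exists>N. packing_pre T t N (\<epsilon> / 3) (W i) < \<infinity>" for i
  proof -
    have "packing_lim T t (\<epsilon> / 3) (W i) \<le> (\<Sum>i. packing_lim T t (\<epsilon> / 3) (W i))"
      using sum_le_suminf[of "\<lambda>i. packing_lim T t (\<epsilon> / 3) (W i)" "{i}"] by simp
    also have "\<dots> < \<infinity>" using W(2) by (rule less_trans) simp
    finally show ?thesis by (simp add: packing_lim_eq_INF INF_less_iff)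
  qed
  then obtain N where N: "\<And>i. packing_pre T t (N i) (\<epsilon> / 3) (W i) < \<infinity>" by metis
  \<comment> \<open>the countably many slacks \<open>1 / (k + 1)\<close> and cover members \<open>W i\<close> need only one null set\<close>
  have "AE x in \<mu>. \<forall>i k. x \<in> W i \<longrightarrow> (\<forall>\<^sub>F n in sequentially.
      exp (- (t + 1 / real (Suc k)) * real n) \<le> measure \<mu> (bowen_ball T n x \<epsilon>))"
    unfolding AE_all_countable
    by (intro allI AE_ball_measure_ge_of_packing_finite[OF T \<mu> \<open>0 < \<epsilon>\<close> _ N]) simp
  with Z show ?thesis
  proof eventually_elim
    case (elim x)
    then obtain i where i: "x \<in> W i" using W(1) by blast
    let ?L = "limsup (\<lambda>n. neg_log (measure \<mu> (bowen_ball T n x \<epsilon>)) / of_nat n)"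
    have "?L \<le> ennreal (t + 1 / real (Suc k))" for k
    proof (rule Limsup_bounded)
      have "\<forall>\<^sub>F n in sequentially. exp (- (t + 1 / real (Suc k)) * real n) \<le> measure \<mu> (bowen_ball T n x \<epsilon>)"
        using elim i by blast
      moreover have "\<forall>\<^sub>F n in sequentially. (1::nat) \<le> n" by (rule eventually_ge_at_top)
      ultimately show "\<forall>\<^sub>F n in sequentially.
          neg_log (measure \<mu> (bowen_ball T n x \<epsilon>)) / of_nat n \<le> ennreal (t + 1 / real (Suc k))"
        by eventually_elim (rule neg_log_over_le, use \<open>0 \<le> t\<close> in auto)
    qed
    moreover have "(\<lambda>k. ennreal (t + 1 / real (Suc k))) \<longlonglongrightarrow> ennreal (t + 0)"
      by (intro tendsto_ennrealI tendsto_add tendsto_const LIMSEQ_Suc[OF lim_1_over_n])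
    ultimately show "?L \<le> ennreal t"
      by (intro LIMSEQ_le_const[of "\<lambda>k. ennreal (t + 1 / real (Suc k))"]) auto
  qed
qed

text \<open>The easy half of the variational principle. Off one null set the local entropy at scale
  \<open>\<epsilon>\<close> is bounded by every \<open>t\<close> with vanishing packing measure at scale \<open>\<epsilon> / 3\<close>; letting \<open>t\<close> and
  \<open>\<epsilon>\<close> run through sequences bounds the integrand almost everywhere by the packing entropy.\<close>

theorem upper_entropy_le_packing_entropy:
  assumes T: "continuous_on UNIV T" and \<mu>: "\<mu> \<in> borel_probs" and Z: "AE x in \<mu>. x \<in> Z"
  shows "upper_entropy T \<mu> \<le> packing_entropy T Z"
proof -
  interpret prob_space \<mu> using \<mu> by (simp add: borel_probs_def)
  define h where "h = packing_entropy T Z"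
  define L where "L \<epsilon> x = limsup (\<lambda>n. neg_log (measure \<mu> (bowen_ball T n x \<epsilon>)) / of_nat n)" for \<epsilon> x
  have L: "AE x in \<mu>. L \<epsilon> x \<le> h" if "0 < \<epsilon>" for \<epsilon>
  proof (cases "h = \<infinity>")
    case False
    have "AE x in \<mu>. L \<epsilon> x \<le> h + ennreal (1 / real (Suc k))" for k
    proof -
      have "packing_entropy_at T Z (\<epsilon> / 3) \<le> h"
        unfolding h_def packing_entropy_eq_SUP by (rule SUP_upper) (use that in auto)
      also have "\<dots> < h + ennreal (1 / real (Suc k))"
        using False by (cases h) (auto simp: ennreal_plus[symmetric] ennreal_less_iff simp del: ennreal_plus)
      finally obtain t where t: "0 \<le> t" "packing_measure T t (\<epsilon> / 3) Z = 0"
        "ennreal t < h + ennreal (1 / real (Suc k))"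
        unfolding packing_entropy_at_def Inf_less_iff by blast
      show ?thesis
        using AE_limsup_le_of_packing_measure_zero[OF T \<mu> Z that t(1,2)]
        by eventually_elim (use t(3) in \<open>auto simp: L_def\<close>)
    qed
    then have "AE x in \<mu>. \<forall>k. L \<epsilon> x \<le> h + ennreal (1 / real (Suc k))"
      by (simp add: AE_all_countable)
    then show ?thesis
    proof eventually_elim
      case (elim x)
      have "(\<lambda>k. h + ennreal (1 / real (Suc k))) \<longlonglongrightarrow> h + ennreal 0"
        by (intro tendsto_add tendsto_ennrealI tendsto_const LIMSEQ_Suc[OF lim_1_over_n])
      with elim show ?case
        by (intro LIMSEQ_le_const[of "\<lambda>k. h + ennreal (1 / real (Suc k))"]) auto
    qed
  qed simp
  have "AE x in \<mu>. \<forall>m. L (1 / real (Suc m)) x \<le> h"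
    unfolding AE_all_countable by (intro allI L) simp
  then have "AE x in \<mu>. local_upper_entropy T \<mu> x \<le> h"
  proof eventually_elim
    case (elim x)
    have "(\<lambda>m. 1 / real (Suc m)) \<longlonglongrightarrow> 0" by (rule LIMSEQ_Suc[OF lim_1_over_n])
    then have "filterlim (\<lambda>m. 1 / real (Suc m)) (at_right 0) sequentially"
      by (auto simp: filterlim_at intro!: always_eventually)
    then have "(\<lambda>m. L (1 / real (Suc m)) x) \<longlonglongrightarrow> local_upper_entropy T \<mu> x"
      using local_upper_entropy_tendsto[OF T \<mu>, of x] unfolding L_def
      by (rule filterlim_compose[rotated])
    with elim show ?case by (intro LIMSEQ_le_const2[of "\<lambda>m. L (1 / real (Suc m)) x"]) auto
  qed
  then have "upper_entropy T \<mu> \<le> (\<integral>\<^sup>+ x. h \<partial>\<mu>)"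
    unfolding upper_entropy_def by (rule nn_integral_mono_AE)
  then show ?thesis by (simp add: h_def emeasure_space_1)
qed

section \<open>The ideal of packing-negligible sets\<close>

text \<open>The \<open>\<sigma>\<close>-ideal generated by the sets of vanishing packing pre-measure. It lies inside the
  ideal of sets of packing measure zero; asking for zero terms in the cover, rather than for
  covers with arbitrarily small sums, makes closure under countable unions immediate.\<close>

definition packing_negligible :: "('a::metric_space \<Rightarrow> 'a) \<Rightarrow> real \<Rightarrow> real \<Rightarrow> 'a set \<Rightarrow> bool" where
  "packing_negligible T t \<epsilon> Z \<longleftrightarrow>
    (\<exists>W :: nat \<Rightarrow> 'a set. Z \<subseteq> (\<Union>i. W i) \<and> (\<forall>i. packing_lim T t \<epsilon> (W i) = 0))"

lemma packing_negligible_subset: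
  "packing_negligible T t \<epsilon> Z \<Longrightarrow> Y \<subseteq> Z \<Longrightarrow> packing_negligible T t \<epsilon> Y"
  unfolding packing_negligible_def by blast

lemma packing_negligible_UN_nat:
  fixes A :: "nat \<Rightarrow> 'a::metric_space set"
  assumes "\<And>i. packing_negligible T t \<epsilon> (A i)"
  shows "packing_negligible T t \<epsilon> (\<Union>i. A i)"
proof -
  obtain W :: "nat \<Rightarrow> nat \<Rightarrow> 'a set" where
    W: "\<And>i. A i \<subseteq> (\<Union>j. W i j)" "\<And>i j. packing_lim T t \<epsilon> (W i j) = 0"
    using assms unfolding packing_negligible_def by metis
  define V where "V n = case_prod W (prod_decode n)" for n
  have "(\<Union>i. A i) \<subseteq> (\<Union>n. V n)"
  proof
    fix x assume "x \<in> (\<Union>i. A i)"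
    then obtain i j where "x \<in> W i j" using W(1) by fast
    then have "x \<in> V (prod_encode (i, j))" by (simp add: V_def)
    then show "x \<in> (\<Union>n. V n)" by fast
  qed
  moreover have "packing_lim T t \<epsilon> (V n) = 0" for n
    by (simp add: V_def W(2) split: prod.split)
  ultimately show ?thesis unfolding packing_negligible_def by blast
qed

lemma packing_negligible_of_lim_zero: "packing_lim T t \<epsilon> W = 0 \<Longrightarrow> packing_negligible T t \<epsilon> W"
  unfolding packing_negligible_def by (intro exI[of _ "\<lambda>_. W"]) auto

lemma packing_negligible_empty: "packing_negligible T t \<epsilon> {}"
proof (rule packing_negligible_of_lim_zero)
  have "packing_pre T t N \<epsilon> {} = 0" for N
    unfolding packing_pre_def by (auto intro!: antisym Sup_least)
  then show "packing_lim T t \<epsilon> {} = 0" by (simp add: packing_lim_eq_INF)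
qed

lemma packing_negligible_Union:
  assumes "countable \<A>" "\<And>A. A \<in> \<A> \<Longrightarrow> packing_negligible T t \<epsilon> A"
  shows "packing_negligible T t \<epsilon> (\<Union>\<A>)"
proof (cases "\<A> = {}")
  case True
  then show ?thesis by (simp add: packing_negligible_empty)
next
  case False
  have "packing_negligible T t \<epsilon> (\<Union>i. from_nat_into \<A> i)"
    by (intro packing_negligible_UN_nat assms(2) from_nat_into[OF False])
  then show ?thesis by (simp add: range_from_nat_into[OF False assms(1)])
qed

lemma packing_measure_zero_of_negligible:
  assumes "packing_negligible T t \<epsilon> Z"
  shows "packing_measure T t \<epsilon> Z = 0"
proof -
  obtain W :: "nat \<Rightarrow> 'a set" where W: "Z \<subseteq> (\<Union>i. W i)" "\<And>i. packing_lim T t \<epsilon> (W i) = 0"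
    using assms unfolding packing_negligible_def by blast
  have "packing_measure T t \<epsilon> Z \<le> (\<Sum>i. packing_lim T t \<epsilon> (W i))"
    unfolding packing_measure_def using W(1) by (intro Inf_lower) blast
  also have "\<dots> = 0" by (simp add: W(2))
  finally show ?thesis by simp
qed

section \<open>Large separated sets\<close>

text \<open>If for all large \<open>n\<close> there were fewer than \<open>exp (s n)\<close> separated points, then a packing sum
  with exponent \<open>t\<close> and orders at least \<open>M\<close>, grouped by order, would be at most
  \<open>(\<Sum>n\<ge>M. exp ((s - t) n))\<close>, which tends to \<open>0\<close> with growing \<open>M\<close>. So a non-vanishing limit
  yields a large separated set whose points all have the same order.\<close>

lemma many_separated_points:
  assumes lim: "packing_lim T t \<epsilon> W \<noteq> 0" and "s < t" "0 < \<epsilon>"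
  shows "\<exists>n\<ge>N. \<exists>E. finite E \<and> E \<subseteq> W \<and> exp (s * real n) \<le> real (card E) \<and>
    (\<forall>x\<in>E. \<forall>y\<in>E. x \<noteq> y \<longrightarrow> \<epsilon> < bowen_dist T n x y)"
proof (rule ccontr)
  assume none: "\<not> ?thesis"
  have few: "real (card E) < exp (s * real n)"
    if "N \<le> n" "finite E" "E \<subseteq> W" "\<forall>x\<in>E. \<forall>y\<in>E. x \<noteq> y \<longrightarrow> \<epsilon> < bowen_dist T n x y"
    for n E
    using none that not_le by metis
  define r where "r = exp (s - t)"
  have r: "0 < r" "r < 1" using \<open>s < t\<close> by (auto simp: r_def)
  have sum_r: "(\<Sum>m. r ^ (m + M)) = r ^ M / (1 - r)" "summable (\<lambda>m. r ^ (m + M))" for M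
  proof -
    have "(\<lambda>m. r ^ M * r ^ m) sums (r ^ M * (1 / (1 - r)))"
      using r by (intro sums_mult geometric_sums) auto
    then have "(\<lambda>m. r ^ (m + M)) sums (r ^ M / (1 - r))"
      by (simp add: power_add mult.commute)
    then show "(\<Sum>m. r ^ (m + M)) = r ^ M / (1 - r)" "summable (\<lambda>m. r ^ (m + M))"
      by (auto simp: sums_iff)
  qed
  have pre: "packing_pre T t M \<epsilon> W \<le> ennreal (r ^ M / (1 - r))" if M: "N \<le> M" for M
    unfolding packing_pre_def
  proof (rule Sup_least, clarify)
    fix I :: "nat set" and x :: "nat \<Rightarrow> 'a" and n :: "nat \<Rightarrow> nat"
    assume xn: "\<forall>i\<in>I. x i \<in> W \<and> M \<le> n i"
      and disj: "disjoint_family_on (\<lambda>i. bowen_cball T (n i) (x i) \<epsilon>) I"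
    have sep: "\<epsilon> < bowen_dist T (n i) (x i) (x j)" if "i \<in> I" "j \<in> I" "i \<noteq> j" for i j
    proof -
      have "x j \<in> bowen_cball T (n j) (x j) \<epsilon>" using \<open>0 < \<epsilon>\<close> by (simp add: bowen_cball_def)
      then have "x j \<notin> bowen_cball T (n i) (x i) \<epsilon>"
        using disj that unfolding disjoint_family_on_def by blast
      then show ?thesis by (simp add: bowen_cball_def)
    qed
    have "(\<Sum>i\<in>J. exp (- t * real (n i))) \<le> r ^ M / (1 - r)" if J: "finite J" "J \<subseteq> I" for J
    proof -
      have ge: "M \<le> n i" if "i \<in> J" for i using that xn J(2) by auto
      have class_le: "(\<Sum>i\<in>{i \<in> J. n i = m}. exp (- t * real (n i))) \<le> r ^ m" if m: "m \<in> n ` J" for m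
      proof -
        let ?J = "{i \<in> J. n i = m}"
        have inj: "inj_on x ?J"
        proof (rule inj_onI, rule ccontr)
          fix i j assume ij: "i \<in> ?J" "j \<in> ?J" "x i = x j" "i \<noteq> j"
          then have "\<epsilon> < bowen_dist T (n i) (x i) (x i)"
            using sep[of i j] J(2) by auto
          then show False using \<open>0 < \<epsilon>\<close> by simp
        qed
        have "real (card (x ` ?J)) < exp (s * real m)"
        proof (rule few)
          show "N \<le> m" using m M J(2) xn by (auto intro: order_trans)
          show "finite (x ` ?J)" using J(1) by simp
          show "x ` ?J \<subseteq> W" using J(2) xn by auto
          show "\<forall>y\<in>x ` ?J. \<forall>z\<in>x ` ?J. y \<noteq> z \<longrightarrow> \<epsilon> < bowen_dist T m y z"
            using sep J(2) by auto
        qed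
        then have card: "real (card ?J) \<le> exp (s * real m)" by (simp add: card_image[OF inj])
        have "(\<Sum>i\<in>?J. exp (- t * real (n i))) = real (card ?J) * exp (- t * real m)" by simp
        also have "\<dots> \<le> exp (s * real m) * exp (- t * real m)"
          by (rule mult_right_mono[OF card]) simp
        also have "\<dots> = exp (real m * (s - t))"
          by (simp only: exp_add[symmetric]) (simp add: algebra_simps)
        also have "\<dots> = r ^ m" unfolding r_def by (rule exp_of_nat_mult)
        finally show ?thesis .
      qed
      have "(\<Sum>i\<in>J. exp (- t * real (n i))) = (\<Sum>m\<in>n ` J. \<Sum>i\<in>{i \<in> J. n i = m}. exp (- t * real (n i)))"
        by (rule sum.image_gen[OF J(1)])
      also have "\<dots> \<le> (\<Sum>m\<in>n ` J. r ^ m)" by (rule sum_mono[OF class_le])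
      also have "\<dots> = sum ((\<lambda>m. r ^ (m + M)) \<circ> (\<lambda>m. m - M)) (n ` J)"
        by (rule sum.cong) (auto simp: ge)
      also have "\<dots> = (\<Sum>m\<in>(\<lambda>m. m - M) ` n ` J. r ^ (m + M))"
        by (rule sum.reindex[symmetric]) (auto intro!: inj_onI simp: ge eq_diff_iff)
      also have "\<dots> \<le> (\<Sum>m. r ^ (m + M))"
        by (rule sum_le_suminf[OF sum_r(2)]) (use J(1) r in auto)
      finally show ?thesis by (simp add: sum_r)
    qed
    then have "(\<Sum>i\<in>J. ennreal (exp (- t * real (n i)))) \<le> ennreal (r ^ M / (1 - r))"
      if "finite J" "J \<subseteq> I" for J
      using that by (subst sum_ennreal) (auto intro!: ennreal_leI)
    then show "(\<Sum>\<^sub>\<infinity>i\<in>I. ennreal (exp (- t * real (n i)))) \<le> ennreal (r ^ M / (1 - r))"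
      by (subst nonneg_infsum_complete) (auto intro!: SUP_least)
  qed
  have "(\<lambda>M. ennreal (r ^ M / (1 - r))) \<longlonglongrightarrow> ennreal (0 / (1 - r))"
    by (intro tendsto_ennrealI tendsto_divide tendsto_const LIMSEQ_power_zero) (use r in auto)
  moreover have "\<forall>M\<ge>N. packing_lim T t \<epsilon> W \<le> ennreal (r ^ M / (1 - r))"
    using pre unfolding packing_lim_eq_INF by (auto intro: INF_lower2)
  ultimately have "packing_lim T t \<epsilon> W \<le> ennreal (0 / (1 - r))"
    by (intro LIMSEQ_le_const) auto
  with lim show False by simp
qed

lemma not_negligible_of_less_packing_entropy_at:
  assumes "ennreal t < packing_entropy_at T Z \<epsilon>" "0 \<le> t"
  shows "\<not> packing_negligible T t \<epsilon> Z"
proof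
  assume "packing_negligible T t \<epsilon> Z"
  then have "packing_entropy_at T Z \<epsilon> \<le> ennreal t"
    unfolding packing_entropy_at_def using assms(2) packing_measure_zero_of_negligible
    by (intro Inf_lower) blast
  with assms(1) show False by simp
qed

section \<open>Branching in sequence space\<close>

text \<open>A pair \<open>(x, l)\<close> stands for the basic open set of all sequences that agree with \<open>x\<close> below
  \<open>l\<close>. Keeping the centre \<open>x\<close> in the representation gives every cylinder a distinguished point.\<close>

definition cylinder :: "(nat \<Rightarrow> nat) \<times> nat \<Rightarrow> (nat \<Rightarrow> nat) set" where
  "cylinder q = {y. \<forall>i<snd q. y i = fst q i}"

lemma mem_cylinder: "y \<in> cylinder q \<longleftrightarrow> (\<forall>i<snd q. y i = fst q i)"
  by (simp add: cylinder_def)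

lemma cylinder_antimono: "m \<le> n \<Longrightarrow> cylinder (x, n) \<subseteq> cylinder (x, m)"
  by (auto simp: cylinder_def)

lemma open_contains_cylinder:
  assumes "open U" "x \<in> U"
  obtains l where "cylinder (x, l) \<subseteq> U"
proof -
  have "openin (product_topology (\<lambda>i. euclidean) UNIV) U"
    using assms(1) by (simp add: open_fun_def)
  then obtain X where X: "x \<in> (\<Pi>\<^sub>E i\<in>UNIV. X i)" "finite {i. X i \<noteq> UNIV}" "(\<Pi>\<^sub>E i\<in>UNIV. X i) \<subseteq> U"
    using product_topology_open_contains_basis[OF _ assms(2), of "\<lambda>i. euclidean" UNIV] by auto
  obtain l where l: "\<forall>i\<in>{i. X i \<noteq> UNIV}. i < l"
    using X(2) finite_nat_set_iff_bounded[of "{i. X i \<noteq> UNIV}"] by auto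
  have "cylinder (x, l) \<subseteq> (\<Pi>\<^sub>E i\<in>UNIV. X i)"
  proof
    fix y assume y: "y \<in> cylinder (x, l)"
    have "y i \<in> X i" for i
    proof (cases "X i = UNIV")
      case False
      then have "y i = x i" using y l by (simp add: cylinder_def)
      then show ?thesis using PiE_mem[OF X(1), of i] by simp
    qed simp
    then show "y \<in> (\<Pi>\<^sub>E i\<in>UNIV. X i)" by (simp add: PiE_UNIV_domain Pi_iff)
  qed
  then have "cylinder (x, l) \<subseteq> U" using X(3) by (rule order_trans)
  then show thesis by (rule that)
qed

text \<open>\<open>P\<close> is what remains of sequence space after removing all cylinders with negligible image.
  There are only countably many cylinders, each given by a finite list, so the
  removed part has negligible image and removing it does not make a non-negligible image
  negligible.\<close>

lemma image_avoiding_negligible_cylinders: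
  fixes f :: "(nat \<Rightarrow> nat) \<Rightarrow> 'a::metric_space" and T :: "'a \<Rightarrow> 'a" and t \<epsilon> :: real
  defines "P \<equiv> {p. \<forall>l. \<not> packing_negligible T t \<epsilon> (f ` cylinder (p, l))}"
  assumes "\<not> packing_negligible T t \<epsilon> (f ` A)"
  shows "\<not> packing_negligible T t \<epsilon> (f ` (P \<inter> A))"
proof
  assume *: "packing_negligible T t \<epsilon> (f ` (P \<inter> A))"
  define C where "C xs = {y. map y [0..<length xs] = xs}" for xs :: "nat list"
  have C: "cylinder (p, l) = C (map p [0..<l])" for p l
    by (auto simp: C_def cylinder_def list_eq_iff_nth_eq)
  define \<A> where "\<A> = insert (f ` (P \<inter> A)) ((\<lambda>xs. f ` C xs) ` {xs. packing_negligible T t \<epsilon> (f ` C xs)})"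
  have "packing_negligible T t \<epsilon> (\<Union>\<A>)"
    by (rule packing_negligible_Union) (use * in \<open>auto simp: \<A>_def\<close>)
  moreover have "f ` A \<subseteq> \<Union>\<A>"
  proof
    fix z assume "z \<in> f ` A"
    then obtain y where y: "y \<in> A" "z = f y" by blast
    show "z \<in> \<Union>\<A>"
    proof (cases "y \<in> P")
      case True
      then show ?thesis using y by (auto simp: \<A>_def)
    next
      case False
      then obtain l where l: "packing_negligible T t \<epsilon> (f ` cylinder (y, l))" by (auto simp: P_def)
      have "y \<in> cylinder (y, l)" by (simp add: cylinder_def)
      with l y(2) show ?thesis unfolding \<A>_def C by blast
    qed
  qed
  ultimately show False using packing_negligible_subset assms(2) by blast
qed

text \<open>One branching step of the tree. The image of \<open>P\<close> in the cylinder contains \<open>exp (s n)\<close>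
  points that are pairwise more than \<open>\<epsilon>\<close> apart in \<open>d\<^sub>n\<close>. Being more than \<open>\<epsilon>\<close> apart is an open
  condition, so preimages of these points can be enclosed in cylinders whose images keep
  the separation.\<close>

lemma separated_children:
  fixes f :: "(nat \<Rightarrow> nat) \<Rightarrow> 'a::metric_space"
  assumes T: "continuous_on UNIV T" and f: "continuous_on UNIV f" and "s < t" "0 < \<epsilon>"
    and nonneg: "\<not> packing_negligible T t \<epsilon> (f ` (P \<inter> cylinder q))"
  shows "\<exists>n k c. snd q < n \<and> exp (s * real n) \<le> real k \<and>
    (\<forall>j<k. fst (c j) \<in> P \<and> cylinder (c j) \<subseteq> cylinder q \<and> n \<le> snd (c j)) \<and>
    (\<forall>i<k. \<forall>j<k. i \<noteq> j \<longrightarrow>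
      (\<forall>u\<in>cylinder (c i). \<forall>v\<in>cylinder (c j). \<epsilon> < bowen_dist T n (f u) (f v)))"
proof -
  have lim: "packing_lim T t \<epsilon> (f ` (P \<inter> cylinder q)) \<noteq> 0"
    using nonneg by (auto dest: packing_negligible_of_lim_zero)
  obtain n E where n: "Suc (snd q) \<le> n" and E: "finite E" "E \<subseteq> f ` (P \<inter> cylinder q)"
    and card: "exp (s * real n) \<le> real (card E)"
    and sep: "\<forall>x\<in>E. \<forall>y\<in>E. x \<noteq> y \<longrightarrow> \<epsilon> < bowen_dist T n x y"
    using many_separated_points[OF lim \<open>s < t\<close> \<open>0 < \<epsilon>\<close>, of "Suc (snd q)"] by auto
  define k where "k = card E"
  obtain b where b: "bij_betw b {..<k} E"
    using ex_bij_betw_nat_finite[OF E(1)] by (auto simp: atLeast0LessThan k_def)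
  have "\<exists>x. x \<in> P \<inter> cylinder q \<and> f x = b j" if "j < k" for j
  proof -
    have "b j \<in> E" using bij_betw_apply[OF b, of j] that by simp
    then have "b j \<in> f ` (P \<inter> cylinder q)" using E(2) by (rule set_mp[rotated])
    then show ?thesis by auto
  qed
  then obtain x where x: "\<And>j. j < k \<Longrightarrow> x j \<in> P \<inter> cylinder q" "\<And>j. j < k \<Longrightarrow> f (x j) = b j"
    by metis
  have near: "\<exists>l. \<forall>u\<in>cylinder (y, l). bowen_dist T n (f y) (f u) < r" if "0 < r" for y r
  proof -
    have "open (f -` bowen_ball T n (f y) r)"
      by (rule open_vimage[OF open_bowen_ball[OF T] f])
    moreover have "y \<in> f -` bowen_ball T n (f y) r" using that by (simp add: bowen_ball_def)
    ultimately obtain l where "cylinder (y, l) \<subseteq> f -` bowen_ball T n (f y) r"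
      by (rule open_contains_cylinder)
    then show ?thesis by (auto simp: bowen_ball_def)
  qed
  \<comment> \<open>half of the slack in the separation; any positive value serves for irrelevant pairs\<close>
  define gap where "gap i j = (if i < k \<and> j < k \<and> i \<noteq> j then (bowen_dist T n (b i) (b j) - \<epsilon>) / 2 else 1)" for i j
  have gap: "0 < gap i j" for i j
  proof (cases "i < k \<and> j < k \<and> i \<noteq> j")
    case True
    then have "b i \<in> E" "b j \<in> E" using bij_betw_apply[OF b] by auto
    moreover have "b i \<noteq> b j"
      using True inj_on_eq_iff[OF bij_betw_imp_inj_on[OF b], of i j] by auto
    ultimately have "\<epsilon> < bowen_dist T n (b i) (b j)" using sep by blast
    then show ?thesis using True by (simp add: gap_def)
  qed (auto simp: gap_def)
  have "\<exists>l. \<forall>u\<in>cylinder (x i, l). bowen_dist T n (f (x i)) (f u) < gap i j" for i j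
    by (rule near[OF gap])
  then obtain l where "\<forall>i j. \<forall>u\<in>cylinder (x i, l i j). bowen_dist T n (f (x i)) (f u) < gap i j"
    by metis
  then have l: "u \<in> cylinder (x i, l i j) \<Longrightarrow> bowen_dist T n (f (x i)) (f u) < gap i j" for i j u
    by blast
  define S where "S = {n, snd q} \<union> (\<lambda>(i, j). l i j) ` ({..<k} \<times> {..<k})"
  have "finite S" by (simp add: S_def)
  then obtain L where "\<forall>m\<in>S. m \<le> L" using finite_nat_set_iff_bounded_le by blast
  then have L: "n \<le> L" "snd q \<le> L" "\<And>i j. i < k \<Longrightarrow> j < k \<Longrightarrow> l i j \<le> L"
    by (auto simp: S_def)
  show ?thesis
  proof (rule exI[of _ n], rule exI[of _ k], rule exI[of _ "\<lambda>j. (x j, L)"],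
      intro conjI allI impI ballI)
    show "snd q < n" "exp (s * real n) \<le> real k" using n card by (auto simp: k_def)
    show "fst (x j, L) \<in> P" "cylinder (x j, L) \<subseteq> cylinder q" "n \<le> snd (x j, L)" if "j < k" for j
      using x(1)[OF that] L by (auto simp: mem_cylinder)
    show "\<epsilon> < bowen_dist T n (f u) (f v)"
      if ij: "i < k" "j < k" "i \<noteq> j" and uv: "u \<in> cylinder (x i, L)" "v \<in> cylinder (x j, L)" for i j u v
    proof -
      have "u \<in> cylinder (x i, l i j)" "v \<in> cylinder (x j, l j i)"
        by (auto intro: subsetD[OF cylinder_antimono[OF L(3)] uv(1)]
            subsetD[OF cylinder_antimono[OF L(3)] uv(2)] ij)
      then have "bowen_dist T n (b i) (f u) < gap i j" "bowen_dist T n (b j) (f v) < gap j i"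
        using l[of u i j] l[of v j i] x(2) ij by auto
      moreover have "gap j i = gap i j" by (simp add: gap_def bowen_dist_commute)
      moreover have "bowen_dist T n (b i) (b j) = \<epsilon> + 2 * gap i j"
        using ij by (simp add: gap_def diff_divide_distrib)
      moreover have "bowen_dist T n (b i) (b j)
          \<le> bowen_dist T n (b i) (f u) + bowen_dist T n (f u) (f v) + bowen_dist T n (f v) (b j)"
        using bowen_dist_triangle[of T n "b i" "b j" "f u"] bowen_dist_triangle[of T n "f u" "b j" "f v"]
        by linarith
      ultimately show ?thesis by (simp add: bowen_dist_commute)
    qed
  qed
qed

section \<open>Lower bounds for upper entropy\<close>

text \<open>The measure of a ball is a lower semicontinuous function of its centre: balls are
  continuous from below in the radius, and a ball of slightly smaller radius is contained in all
  \<open>\<epsilon>\<close>-balls with nearby centres.\<close>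

lemma closed_ball_measure_le:
  assumes T: "continuous_on UNIV T" and \<mu>: "\<mu> \<in> borel_probs"
  shows "closed {x. measure \<mu> (bowen_ball T n x \<epsilon>) \<le> c}"
proof -
  interpret prob_space \<mu> using \<mu> by (simp add: borel_probs_def)
  have ball: "bowen_ball T n x r \<in> sets \<mu>" for x r
    using open_bowen_ball[OF T] \<mu> by (simp add: borel_probs_def)
  have "open {x. c < measure \<mu> (bowen_ball T n x \<epsilon>)}"
  proof (subst open_subopen, clarify)
    fix x assume x: "c < measure \<mu> (bowen_ball T n x \<epsilon>)"
    define A where "A m = bowen_ball T n x (\<epsilon> - 1 / real (Suc m))" for m
    have "(\<lambda>m. measure \<mu> (A m)) \<longlonglongrightarrow> measure \<mu> (\<Union>m. A m)"
    proof (rule finite_Lim_measure_incseq)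
      show "range A \<subseteq> sets \<mu>" using ball by (auto simp: A_def)
      show "incseq A"
      proof (rule incseq_SucI)
        fix m
        have "1 / real (Suc (Suc m)) \<le> 1 / real (Suc m)" by (simp add: field_simps)
        then show "A m \<subseteq> A (Suc m)" unfolding A_def bowen_ball_def by fastforce
      qed
    qed
    also have "(\<Union>m. A m) = bowen_ball T n x \<epsilon>"
    proof (intro equalityI subsetI)
      fix y assume "y \<in> bowen_ball T n x \<epsilon>"
      then have "0 < \<epsilon> - bowen_dist T n x y" by (simp add: bowen_ball_def)
      then obtain m where "1 / real (Suc m) < \<epsilon> - bowen_dist T n x y"
        using nat_approx_posE by blast
      then have "y \<in> A m" by (simp add: A_def bowen_ball_def)
      then show "y \<in> (\<Union>m. A m)" by blast
    next
      fix y assume "y \<in> (\<Union>m. A m)"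
      then obtain m where "bowen_dist T n x y < \<epsilon> - 1 / real (Suc m)"
        by (auto simp: A_def bowen_ball_def)
      moreover have "0 \<le> 1 / real (Suc m)" by simp
      ultimately have "bowen_dist T n x y < \<epsilon>" by linarith
      then show "y \<in> bowen_ball T n x \<epsilon>" by (simp add: bowen_ball_def)
    qed
    finally have "\<forall>\<^sub>F m in sequentially. c < measure \<mu> (A m)"
      using x by (rule order_tendstoD(1))
    then obtain m where m: "c < measure \<mu> (A m)" by (auto simp: eventually_sequentially)
    let ?V = "bowen_ball T n x (1 / real (Suc m))"
    have "c < measure \<mu> (bowen_ball T n y \<epsilon>)" if y: "y \<in> ?V" for y
    proof -
      have "A m \<subseteq> bowen_ball T n y \<epsilon>"
      proof
        fix z assume "z \<in> A m"
        then have "bowen_dist T n x z < \<epsilon> - 1 / real (Suc m)" by (simp add: A_def bowen_ball_def)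
        moreover have "bowen_dist T n y x < 1 / real (Suc m)"
          using y by (simp add: bowen_ball_def bowen_dist_commute)
        ultimately have "bowen_dist T n y z < \<epsilon>"
          using bowen_dist_triangle[of T n y z x] by linarith
        then show "z \<in> bowen_ball T n y \<epsilon>" by (simp add: bowen_ball_def)
      qed
      then have "measure \<mu> (A m) \<le> measure \<mu> (bowen_ball T n y \<epsilon>)"
        by (rule finite_measure_mono[OF _ ball])
      with m show ?thesis by linarith
    qed
    then show "\<exists>V. open V \<and> x \<in> V \<and> V \<subseteq> {x. c < measure \<mu> (bowen_ball T n x \<epsilon>)}"
      using open_bowen_ball[OF T] by (intro exI[of _ ?V]) (auto simp: bowen_ball_def)
  qed
  moreover have "{x. measure \<mu> (bowen_ball T n x \<epsilon>) \<le> c} = - {x. c < measure \<mu> (bowen_ball T n x \<epsilon>)}"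
    by auto
  ultimately show ?thesis by (simp add: closed_Compl)
qed

text \<open>Measurability allows the almost sure smallness of balls to be checked on the parameter
  space when the measure is a push-forward.\<close>

lemma borel_frequently_small_balls:
  assumes "continuous_on UNIV T" "\<mu> \<in> borel_probs"
  shows "{x. \<exists>\<^sub>\<infinity>n. measure \<mu> (bowen_ball T n x \<epsilon>) \<le> g n} \<in> sets borel"
proof -
  have "{x. \<exists>\<^sub>\<infinity>n. measure \<mu> (bowen_ball T n x \<epsilon>) \<le> g n} =
      (\<Inter>m. \<Union>n\<in>{m..}. {x. measure \<mu> (bowen_ball T n x \<epsilon>) \<le> g n})"
    by (auto simp: INFM_nat_le)
  also have "\<dots> \<in> sets borel"
    by (intro sets.countable_INT image_subsetI sets.countable_UN'' borel_closed
        closed_ball_measure_le assms) auto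
  finally show ?thesis .
qed

lemma neg_log_over_ge:
  assumes "r \<le> exp (- s * real n)" "0 \<le> r" "1 \<le> n"
  shows "ennreal s \<le> neg_log r / of_nat n"
proof (cases "r = 0")
  case True
  then show ?thesis using assms(3) by (simp add: neg_log_def ennreal_top_divide)
next
  case False
  then have r: "0 < r" using assms(2) by simp
  then have "ln r \<le> ln (exp (- s * real n))" using assms(1) by (subst ln_le_cancel_iff) auto
  then have "s * real n \<le> - ln r" by simp
  then have "s \<le> - ln r / real n" using assms(3) by (simp add: field_simps)
  have "ennreal s * of_nat n \<le> ennreal (- ln r)"
  proof (cases "0 \<le> s")
    case True
    then show ?thesis using \<open>s * real n \<le> - ln r\<close>
      by (simp add: ennreal_of_nat_eq_real_of_nat ennreal_mult[symmetric] ennreal_leI)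
  qed (simp add: ennreal_neg)
  then have "ennreal s * of_nat n / of_nat n \<le> ennreal (- ln r) / of_nat n"
    by (rule divide_right_mono_ennreal)
  moreover have "ennreal s * of_nat n / of_nat n = ennreal s"
    using assms(3) by (intro ennreal_mult_divide_eq) (auto simp: of_nat_less_top)
  ultimately show ?thesis using False by (simp add: neg_log_def)
qed

lemma upper_entropy_ge_of_small_balls:
  assumes T: "continuous_on UNIV T" and \<mu>: "\<mu> \<in> borel_probs" and "0 < \<epsilon>"
    and small: "AE x in \<mu>. \<exists>\<^sub>\<infinity>n. measure \<mu> (bowen_ball T n x \<epsilon>) \<le> exp (- s * real n)"
  shows "ennreal s \<le> upper_entropy T \<mu>"
proof -
  interpret prob_space \<mu> using \<mu> by (simp add: borel_probs_def)
  have "AE x in \<mu>. ennreal s \<le> local_upper_entropy T \<mu> x"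
    using small
  proof eventually_elim
    case (elim x)
    let ?h = "\<lambda>n. neg_log (measure \<mu> (bowen_ball T n x \<epsilon>)) / of_nat n"
    have "\<exists>\<^sub>F n in sequentially. measure \<mu> (bowen_ball T n x \<epsilon>) \<le> exp (- s * real n)"
      using elim by (simp add: cofinite_eq_sequentially)
    then have "\<exists>\<^sub>F n in sequentially. measure \<mu> (bowen_ball T n x \<epsilon>) \<le> exp (- s * real n) \<and> 1 \<le> n"
      by (rule frequently_eventually_frequently[OF _ eventually_ge_at_top])
    then have freq: "\<exists>\<^sub>F n in sequentially. ennreal s \<le> ?h n"
      by (rule frequently_elim1) (intro neg_log_over_ge, auto)
    have "ennreal s \<le> limsup ?h"
    proof (rule ccontr)
      assume "\<not> ennreal s \<le> limsup ?h"
      then have "\<forall>\<^sub>F n in sequentially. ?h n < ennreal s"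
        by (intro Limsup_lessD) simp
      with freq show False by (simp add: frequently_def not_le)
    qed
    also have "\<dots> \<le> local_upper_entropy T \<mu> x"
      unfolding local_upper_entropy_eq_SUP[OF T \<mu>] by (rule SUP_upper) (use \<open>0 < \<epsilon>\<close> in simp)
    finally show ?case .
  qed
  then have "(\<integral>\<^sup>+ x. ennreal s \<partial>\<mu>) \<le> upper_entropy T \<mu>"
    unfolding upper_entropy_def by (rule nn_integral_mono_AE)
  then show ?thesis by (simp add: emeasure_space_1)
qed

section \<open>The random branch of a separated tree\<close>

definition unit_measure :: "real measure" where
  "unit_measure = restrict_space lborel {0..<1}"

lemma prob_space_unit_measure: "prob_space unit_measure"
  by (rule prob_spaceI)
    (simp add: unit_measure_def emeasure_restrict_space space_restrict_space)

lemma space_unit_measure [simp]: "space unit_measure = {0..<1}"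
  by (simp add: unit_measure_def space_restrict_space)

lemma measure_unit_measure_le:
  assumes "A \<in> sets unit_measure" "A \<subseteq> {a..<b}" "a \<le> b"
  shows "measure unit_measure A \<le> b - a"
proof -
  have "A \<subseteq> {0..<1}" using sets.sets_into_space[OF assms(1)] by simp
  then have "emeasure unit_measure A = emeasure lborel A"
    by (simp add: unit_measure_def emeasure_restrict_space)
  also have "\<dots> \<le> emeasure lborel {a..<b}"
    using assms(2) by (rule emeasure_mono) simp
  also have "\<dots> = ennreal (b - a)" using assms(3) by simp
  finally show ?thesis using assms(3) by (simp add: measure_def enn2real_leI)
qed

text \<open>An infinite tree of cylinders. The node \<open>q\<close> has \<open>deg q \<ge> exp (s (time q))\<close> children, and
  the images of different children are more than \<open>\<epsilon>\<close> apart at time \<open>time q\<close>. The inequalities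
  between times and lengths make both grow strictly along every branch.

  A number \<open>u\<close> in the unit interval selects the child of \<open>q\<close> with index \<open>\<lfloor>u (deg q)\<rfloor>\<close>, at all nodes
  simultaneously. The choices at different nodes are thus strongly dependent, but this is harmless:
  the entropy bound only uses that every single node selects each of its children with
  probability \<open>1 / deg q\<close>. The image of Lebesgue measure under the resulting random branch, mapped to
  the space by \<open>f\<close>, is the measure sought.\<close>

locale separated_tree =
  fixes T :: "'a::metric_space \<Rightarrow> 'a" and f :: "(nat \<Rightarrow> nat) \<Rightarrow> 'a" and s \<epsilon> :: real
    and root :: "(nat \<Rightarrow> nat) \<times> nat" and nodes :: "((nat \<Rightarrow> nat) \<times> nat) set"
    and time deg :: "(nat \<Rightarrow> nat) \<times> nat \<Rightarrow> nat"
    and child :: "(nat \<Rightarrow> nat) \<times> nat \<Rightarrow> nat \<Rightarrow> (nat \<Rightarrow> nat) \<times> nat"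
  assumes T: "continuous_on UNIV T" and f: "continuous_on UNIV f" and eps: "0 < \<epsilon>"
    and root: "root \<in> nodes"
    and time: "q \<in> nodes \<Longrightarrow> snd q < time q"
    and deg: "q \<in> nodes \<Longrightarrow> exp (s * real (time q)) \<le> real (deg q)"
    and child: "q \<in> nodes \<Longrightarrow> j < deg q \<Longrightarrow> child q j \<in> nodes"
      "q \<in> nodes \<Longrightarrow> j < deg q \<Longrightarrow> cylinder (child q j) \<subseteq> cylinder q"
      "q \<in> nodes \<Longrightarrow> j < deg q \<Longrightarrow> time q \<le> snd (child q j)"
    and separated: "q \<in> nodes \<Longrightarrow> i < deg q \<Longrightarrow> j < deg q \<Longrightarrow> i \<noteq> j \<Longrightarrow> u \<in> cylinder (child q i) \<Longrightarrow>
      v \<in> cylinder (child q j) \<Longrightarrow> \<epsilon> < bowen_dist T (time q) (f u) (f v)"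
begin

definition turn :: "(nat \<Rightarrow> nat) \<times> nat \<Rightarrow> real \<Rightarrow> nat" where
  "turn q u = nat \<lfloor>u * real (deg q)\<rfloor>"

primrec node :: "nat \<Rightarrow> real \<Rightarrow> (nat \<Rightarrow> nat) \<times> nat" where
  "node 0 u = root"
| "node (Suc i) u = child (node i u) (turn (node i u) u)"

text \<open>The unique sequence in all cylinders along the path of \<open>u\<close>: its entry \<open>j\<close> is settled from
  depth \<open>j + 1\<close> on, where cylinders have length greater than \<open>j\<close>.\<close>

definition branch :: "real \<Rightarrow> nat \<Rightarrow> nat" where
  "branch u j = fst (node (Suc j) u) j"

lemma deg_pos: "q \<in> nodes \<Longrightarrow> 0 < deg q"
  using deg[of q] by (auto intro: Nat.gr0I simp: exp_gt_zero[THEN less_le_trans])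

lemma turn_less: "q \<in> nodes \<Longrightarrow> u \<in> {0..<1} \<Longrightarrow> turn q u < deg q"
proof -
  assume q: "q \<in> nodes" and u: "u \<in> {0..<1}"
  have "u * real (deg q) < real (deg q)" using u deg_pos[OF q] by simp
  then have "\<lfloor>u * real (deg q)\<rfloor> < int (deg q)" by (simp add: floor_less_iff)
  then show ?thesis unfolding turn_def using deg_pos[OF q] by linarith
qed

lemma turn_bounds:
  assumes "q \<in> nodes" "u \<in> {0..<1}" "turn q u = j"
  shows "u \<in> {real j / real (deg q)..<(real j + 1) / real (deg q)}"
proof -
  have "0 \<le> u * real (deg q)" using assms(2) by simp
  then have "real j \<le> u * real (deg q)" "u * real (deg q) < real j + 1"
    using assms(3) unfolding turn_def by linarith+
  then show ?thesis using deg_pos[OF assms(1)] by (simp add: field_simps)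
qed

lemma node_in_nodes: "u \<in> {0..<1} \<Longrightarrow> node i u \<in> nodes"
  by (induction i) (simp_all add: root child turn_less)

lemma cylinder_node_antimono:
  assumes "u \<in> {0..<1}" "i \<le> j"
  shows "cylinder (node j u) \<subseteq> cylinder (node i u)"
  using assms(2)
proof (induction rule: dec_induct)
  case (step j)
  have "cylinder (node (Suc j) u) \<subseteq> cylinder (node j u)"
    using child(2) node_in_nodes turn_less assms(1) by simp
  with step.IH show ?case by blast
qed simp

lemma time_less_time_Suc:
  assumes "u \<in> {0..<1}"
  shows "time (node i u) < time (node (Suc i) u)"
proof -
  have "time (node i u) \<le> snd (node (Suc i) u)"
    using child(3) node_in_nodes turn_less assms by simp
  also have "\<dots> < time (node (Suc i) u)" by (rule time[OF node_in_nodes[OF assms]])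
  finally show ?thesis .
qed

lemma strict_mono_time: "u \<in> {0..<1} \<Longrightarrow> strict_mono (\<lambda>i. time (node i u))"
  unfolding strict_mono_Suc_iff using time_less_time_Suc by blast

lemma depth_node_ge:
  assumes "u \<in> {0..<1}"
  shows "i \<le> snd (node i u)"
proof (induction i)
  case (Suc i)
  have "snd (node i u) < time (node i u)" by (rule time[OF node_in_nodes[OF assms]])
  also have "\<dots> \<le> snd (node (Suc i) u)"
    using child(3) node_in_nodes turn_less assms by simp
  finally show ?case using Suc by linarith
qed simp

lemma branch_in_cylinder_node:
  assumes u: "u \<in> {0..<1}"
  shows "branch u \<in> cylinder (node i u)"
  unfolding mem_cylinder
proof (intro allI impI)
  fix k assume k: "k < snd (node i u)"
  have k': "k < snd (node (Suc k) u)" using depth_node_ge[OF u, of "Suc k"] by linarith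
  have centre: "fst q \<in> cylinder q" for q by (simp add: mem_cylinder)
  show "branch u k = fst (node i u) k"
  proof (cases "Suc k \<le> i")
    case True
    have "fst (node i u) \<in> cylinder (node (Suc k) u)"
      using cylinder_node_antimono[OF u True] centre by (rule subsetD)
    then show ?thesis using k' by (simp add: branch_def mem_cylinder)
  next
    case False
    then have "i \<le> Suc k" by simp
    then have "fst (node (Suc k) u) \<in> cylinder (node i u)"
      by (intro subsetD[OF cylinder_node_antimono[OF u] centre])
    then show ?thesis using k by (simp add: branch_def mem_cylinder)
  qed
qed

lemma measurable_turn: "turn q \<in> measurable unit_measure (count_space UNIV)"
proof -
  have "(\<lambda>u. u * real (deg q)) \<in> borel_measurable lborel" by simp
  then have "(\<lambda>u. \<lfloor>u * real (deg q)\<rfloor>) \<in> measurable lborel (count_space UNIV)"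
    by (rule measurable_compose[OF _ measurable_real_floor])
  then have "(\<lambda>u. nat \<lfloor>u * real (deg q)\<rfloor>) \<in> measurable lborel (count_space UNIV)"
    by (rule measurable_compose) simp
  then show ?thesis
    unfolding turn_def unit_measure_def by (rule measurable_restrict_space1)
qed

text \<open>At each depth only finitely many nodes occur, and the path to depth \<open>i\<close> depends on \<open>u\<close>
  through finitely many rounded multiples. The finiteness is also what confines
  the branches to a compact set.\<close>

lemma measurable_node:
  "\<exists>I. finite I \<and> I \<subseteq> nodes \<and> node i \<in> measurable unit_measure (count_space I)"
proof (induction i)
  case 0
  show ?case by (rule exI[of _ "{root}"]) (simp add: root)
next
  case (Suc i)
  then obtain I where I: "finite I" "I \<subseteq> nodes" "node i \<in> measurable unit_measure (count_space I)"
    by blast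
  define J where "J = (\<Union>q\<in>I. child q ` {..<deg q})"
  have J: "finite J" "J \<subseteq> nodes" using I(1,2) child(1) by (auto simp: J_def)
  have step: "(\<lambda>u. child q (turn q u)) \<in> measurable unit_measure (count_space J)" if q: "q \<in> I" for q
    unfolding measurable_count_space_eq2[OF J(1)]
  proof (intro conjI ballI)
    have "turn q u < deg q" if "u \<in> {0..<1}" for u
      using q I(2) that by (intro turn_less) auto
    then show "(\<lambda>u. child q (turn q u)) \<in> space unit_measure \<rightarrow> J"
      using q by (auto simp: J_def)
    fix a
    have "turn q -` (child q -` {a}) \<inter> space unit_measure \<in> sets unit_measure"
      by (rule measurable_sets[OF measurable_turn]) simp
    then show "(\<lambda>u. child q (turn q u)) -` {a} \<inter> space unit_measure \<in> sets unit_measure"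
      by (simp add: vimage_def)
  qed
  have "(\<lambda>u. child (node i u) (turn (node i u) u)) \<in> measurable unit_measure (count_space J)"
    by (rule measurable_compose_countable'[where f = "\<lambda>q u. child q (turn q u)", OF step I(3)])
      (simp_all add: I(1) countable_finite)
  then show ?case using J by auto
qed

lemma tendsto_image_branch:
  assumes u: "u \<in> {0..<1}"
  shows "(\<lambda>i. f (fst (node i u))) \<longlonglongrightarrow> f (branch u)"
proof (rule topological_tendstoI)
  fix U assume U: "open U" "f (branch u) \<in> U"
  have "open (f -` U)" by (rule open_vimage[OF U(1) f])
  moreover have "branch u \<in> f -` U" using U(2) by simp
  ultimately obtain l where l: "cylinder (branch u, l) \<subseteq> f -` U"
    by (rule open_contains_cylinder)
  have "f (fst (node i u)) \<in> U" if "l \<le> i" for i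
  proof -
    have "fst (node i u) \<in> cylinder (branch u, l)"
      using branch_in_cylinder_node[OF u, of i] depth_node_ge[OF u, of i] that
      by (auto simp: mem_cylinder)
    then show ?thesis using l by auto
  qed
  then show "\<forall>\<^sub>F i in sequentially. f (fst (node i u)) \<in> U"
    by (auto simp: eventually_sequentially)
qed

text \<open>A pointwise limit of functions with finitely many values.\<close>

lemma measurable_image_branch: "(\<lambda>u. f (branch u)) \<in> borel_measurable unit_measure"
proof (rule borel_measurable_LIMSEQ_metric)
  show "(\<lambda>u. f (fst (node i u))) \<in> borel_measurable unit_measure" for i
  proof -
    obtain I where "node i \<in> measurable unit_measure (count_space I)"
      using measurable_node by blast
    then show ?thesis by (rule measurable_compose) simp
  qed
  show "(\<lambda>i. f (fst (node i u))) \<longlonglongrightarrow> f (branch u)" if "u \<in> space unit_measure" for u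
    using that by (intro tendsto_image_branch) simp
qed

text \<open>Each coordinate of a branch takes only finitely many values, so Tychonoff's theorem applies
  to the product of these value sets.\<close>

lemma compact_branch_superset:
  shows "\<exists>D. compact D \<and> branch ` {0..<1} \<subseteq> D"
proof -
  define F where "F j = (\<lambda>u. branch u j) ` {0..<1}" for j
  have fin: "finite (F j)" for j
  proof -
    obtain I where I: "finite I" "node (Suc j) \<in> measurable unit_measure (count_space I)"
      using measurable_node by blast
    have "node (Suc j) u \<in> I" if "u \<in> {0..<1}" for u
      using measurable_space[OF I(2), of u] that by simp
    then have "F j \<subseteq> (\<lambda>q. fst q j) ` I" by (auto simp: F_def branch_def simp del: node.simps)
    then show ?thesis using I(1) by (rule finite_subset[OF _ finite_imageI])
  qed
  have "compactin (product_topology (\<lambda>i. euclidean) UNIV) (\<Pi>\<^sub>E j\<in>UNIV. F j)"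
    by (simp add: compactin_PiE finite_imp_compact[OF fin])
  then have "compact (\<Pi>\<^sub>E j\<in>UNIV. F j)"
    by (simp add: euclidean_product_topology)
  moreover have "branch ` {0..<1} \<subseteq> (\<Pi>\<^sub>E j\<in>UNIV. F j)"
    by (auto simp: PiE_UNIV_domain F_def)
  ultimately show ?thesis by blast
qed

text \<open>Two branches whose images are \<open>\<epsilon>\<close>-close up to the time of the node at depth \<open>i\<close> cannot part
  at that node or at an earlier one: parting at depth \<open>j \<le> i\<close> separates them at the smaller time
  of that node, hence also at the later time.\<close>

lemma close_branches_agree:
  assumes u: "u \<in> {0..<1}" and v: "v \<in> {0..<1}"
    and close: "bowen_dist T (time (node i u)) (f (branch u)) (f (branch v)) \<le> \<epsilon>"
  shows "turn (node i u) v = turn (node i u) u"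
proof -
  have turn: "turn (node j u) v = turn (node j u) u" if "j \<le> i" and same: "node j v = node j u" for j
  proof (rule ccontr)
    assume ne: "turn (node j u) v \<noteq> turn (node j u) u"
    have "\<epsilon> < bowen_dist T (time (node j u)) (f (branch u)) (f (branch v))"
    proof (rule separated[OF node_in_nodes[OF u]])
      show "turn (node j u) u < deg (node j u)" "turn (node j u) v < deg (node j u)"
        using turn_less node_in_nodes u v by blast+
      show "turn (node j u) u \<noteq> turn (node j u) v" using ne by simp
      show "branch u \<in> cylinder (child (node j u) (turn (node j u) u))"
        using branch_in_cylinder_node[OF u, of "Suc j"] by simp
      show "branch v \<in> cylinder (child (node j u) (turn (node j u) v))"
        using branch_in_cylinder_node[OF v, of "Suc j"] same by simp
    qed
    also have "\<dots> \<le> bowen_dist T (time (node i u)) (f (branch u)) (f (branch v))"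
      by (intro bowen_dist_mono strict_mono_leD[OF strict_mono_time[OF u] \<open>j \<le> i\<close>])
    finally show False using close by simp
  qed
  have "node j v = node j u" if "j \<le> i" for j
    using that by (induction j) (auto simp: turn)
  then show ?thesis using turn by blast
qed

definition branch_measure :: "'a measure" where
  "branch_measure = distr unit_measure borel (\<lambda>u. f (branch u))"

lemma branch_measure_in_borel_probs: "branch_measure \<in> borel_probs"
  unfolding borel_probs_def branch_measure_def
  using prob_space.prob_space_distr[OF prob_space_unit_measure measurable_image_branch] by simp

text \<open>All parameters whose branch falls into the ball make the same choice at the node of depth
  \<open>i\<close> as \<open>u\<close> does, so they lie in one interval of length \<open>1 / deg\<close>.\<close>

lemma branch_measure_ball_le:
  assumes u: "u \<in> {0..<1}"
  shows "measure branch_measure (bowen_ball T (time (node i u)) (f (branch u)) \<epsilon>)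
    \<le> exp (- s * real (time (node i u)))"
proof -
  let ?q = "node i u"
  let ?B = "bowen_ball T (time ?q) (f (branch u)) \<epsilon>"
  let ?A = "(\<lambda>v. f (branch v)) -` ?B \<inter> space unit_measure"
  let ?j = "turn ?q u"
  have B: "?B \<in> sets borel" using open_bowen_ball[OF T] by simp
  have "measure branch_measure ?B = measure unit_measure ?A"
    unfolding branch_measure_def by (rule measure_distr[OF measurable_image_branch B])
  also have "\<dots> \<le> (real ?j + 1) / real (deg ?q) - real ?j / real (deg ?q)"
  proof (rule measure_unit_measure_le)
    show "?A \<in> sets unit_measure" by (rule measurable_sets[OF measurable_image_branch B])
    show "?A \<subseteq> {real ?j / real (deg ?q)..<(real ?j + 1) / real (deg ?q)}"
    proof
      fix v assume "v \<in> ?A"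
      then have v: "v \<in> {0..<1}" "bowen_dist T (time ?q) (f (branch u)) (f (branch v)) \<le> \<epsilon>"
        by (auto simp: bowen_ball_def)
      show "v \<in> {real ?j / real (deg ?q)..<(real ?j + 1) / real (deg ?q)}"
        by (rule turn_bounds[OF node_in_nodes[OF u] v(1) close_branches_agree[OF u v]])
    qed
    show "real ?j / real (deg ?q) \<le> (real ?j + 1) / real (deg ?q)"
      by (rule divide_right_mono) auto
  qed
  also have "\<dots> = 1 / real (deg ?q)" by (simp add: diff_divide_distrib[symmetric])
  also have "\<dots> \<le> 1 / exp (s * real (time ?q))"
    using deg[OF node_in_nodes[OF u]] deg_pos[OF node_in_nodes[OF u]]
    by (intro divide_left_mono) auto
  also have "\<dots> = exp (- s * real (time ?q))" by (simp add: exp_minus inverse_eq_divide)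
  finally show ?thesis .
qed

theorem upper_entropy_branch_measure_ge: "ennreal s \<le> upper_entropy T branch_measure"
proof (rule upper_entropy_ge_of_small_balls[OF T branch_measure_in_borel_probs eps])
  let ?Q = "\<lambda>x. \<exists>\<^sub>\<infinity>n. measure branch_measure (bowen_ball T n x \<epsilon>) \<le> exp (- s * real n)"
  have "?Q (f (branch u))" if "u \<in> {0..<1}" for u
    unfolding INFM_nat_le
  proof
    fix m
    have "m \<le> time (node m u)"
      using strict_mono_imp_increasing[OF strict_mono_time[OF that]] .
    then show "\<exists>n\<ge>m. measure branch_measure (bowen_ball T n (f (branch u)) \<epsilon>) \<le> exp (- s * real n)"
      using branch_measure_ball_le[OF that] by blast
  qed
  then have "AE u in unit_measure. ?Q (f (branch u))" by (intro AE_I2) simp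
  moreover have "{x \<in> space borel. ?Q x} \<in> sets borel"
    using borel_frequently_small_balls[OF T branch_measure_in_borel_probs] by simp
  ultimately show "AE x in branch_measure. ?Q x"
    by (subst (2) branch_measure_def) (simp only: AE_distr_iff[OF measurable_image_branch])
qed

theorem compact_carrier:
  "\<exists>K. K \<subseteq> range f \<and> compact K \<and> measure branch_measure K = 1"
proof -
  obtain D where D: "compact D" "branch ` {0..<1} \<subseteq> D"
    using compact_branch_superset by blast
  have K: "compact (f ` D)"
    by (rule compact_continuous_image[OF continuous_on_subset[OF f] D(1)]) simp
  then have borel: "f ` D \<in> sets borel" by (intro borel_closed compact_imp_closed)
  have "measure branch_measure (f ` D) =
      measure unit_measure ((\<lambda>u. f (branch u)) -` (f ` D) \<inter> space unit_measure)"
    unfolding branch_measure_def by (rule measure_distr[OF measurable_image_branch borel])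
  also have "(\<lambda>u. f (branch u)) -` (f ` D) \<inter> space unit_measure = space unit_measure"
  proof -
    have "f (branch u) \<in> f ` D" if "u \<in> {0..<1}" for u using D(2) that by (intro imageI) auto
    then show ?thesis by (auto simp del: atLeastLessThan_iff)
  qed
  also have "measure unit_measure (space unit_measure) = 1"
    by (rule prob_space.prob_space[OF prob_space_unit_measure])
  finally have "measure branch_measure (f ` D) = 1" .
  with K show ?thesis by (intro exI[of _ "f ` D"] conjI image_mono) auto
qed

end

section \<open>Measures of large entropy on analytic sets\<close>

text \<open>The hard half of both claims. Strictly between \<open>c\<close> and the packing entropy at a suitable
  scale lie numbers \<open>s < t\<close>; the range of \<open>f\<close> is not negligible for \<open>t\<close>, and the gap between \<open>s\<close>
  and \<open>t\<close> pays for the pigeonhole argument in every branching step.\<close>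

theorem measure_with_large_upper_entropy:
  fixes f :: "(nat \<Rightarrow> nat) \<Rightarrow> 'a::metric_space"
  assumes T: "continuous_on UNIV T" and f: "continuous_on UNIV f"
    and c: "c < packing_entropy T (range f)"
  shows "\<exists>K \<mu>. K \<subseteq> range f \<and> compact K \<and> \<mu> \<in> borel_probs \<and> measure \<mu> K = 1 \<and> c < upper_entropy T \<mu>"
proof -
  obtain \<epsilon> where \<epsilon>: "0 < \<epsilon>" "c < packing_entropy_at T (range f) \<epsilon>"
    using c by (auto simp: packing_entropy_eq_SUP less_SUP_iff)
  obtain b where b: "c < b" "b < packing_entropy_at T (range f) \<epsilon>" using dense[OF \<epsilon>(2)] by blast
  obtain a where a: "c < a" "a < b" using dense[OF b(1)] by blast
  have "b < \<infinity>" using b(2) by (rule less_le_trans) simp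
  then obtain t where t: "0 \<le> t" "b = ennreal t" by (cases b) auto
  have "a < \<infinity>" using a(2) \<open>b < \<infinity>\<close> by (rule less_trans)
  then obtain s where s: "0 \<le> s" "a = ennreal s" by (cases a) auto
  have "s < t" using a(2) s t by (simp add: ennreal_less_iff)
  define P where "P = {p. \<forall>l. \<not> packing_negligible T t \<epsilon> (f ` cylinder (p, l))}"
  have kernel: "\<not> packing_negligible T t \<epsilon> (f ` (P \<inter> A))" if "\<not> packing_negligible T t \<epsilon> (f ` A)" for A
    using image_avoiding_negligible_cylinders[OF that] by (simp add: P_def)
  have "\<not> packing_negligible T t \<epsilon> (f ` UNIV)"
    using not_negligible_of_less_packing_entropy_at b(2) t by blast
  then have "\<not> packing_negligible T t \<epsilon> (f ` (P \<inter> UNIV))" by (rule kernel)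
  then have "P \<noteq> {}" using packing_negligible_empty[of T t \<epsilon>] by auto
  then obtain p where p: "p \<in> P" by blast
  define good where "good q n k c \<longleftrightarrow> snd q < n \<and> exp (s * real n) \<le> real k \<and>
    (\<forall>j<k. fst (c j) \<in> P \<and> cylinder (c j) \<subseteq> cylinder q \<and> n \<le> snd (c j)) \<and>
    (\<forall>i<k. \<forall>j<k. i \<noteq> j \<longrightarrow>
      (\<forall>u\<in>cylinder (c i). \<forall>v\<in>cylinder (c j). \<epsilon> < bowen_dist T n (f u) (f v)))"
    for q and n k :: nat and c
  have "\<exists>n k c. good q n k c" if "fst q \<in> P" for q
    unfolding good_def
  proof (rule separated_children[OF T f \<open>s < t\<close> \<open>0 < \<epsilon>\<close>], rule kernel)
    show "\<not> packing_negligible T t \<epsilon> (f ` cylinder q)"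
      using that by (cases q) (simp add: P_def)
  qed
  then obtain time deg child where good: "\<And>q. fst q \<in> P \<Longrightarrow> good q (time q) (deg q) (child q)"
    by metis
  \<comment> \<open>the nodes are the cylinders centred in \<open>P\<close>, the root being the whole space\<close>
  interpret separated_tree T f s \<epsilon> "(p, 0)" "{q. fst q \<in> P}" time deg child
    by unfold_locales (use T f \<epsilon>(1) p good in \<open>auto simp: good_def\<close>)
  obtain K where "K \<subseteq> range f" "compact K" "measure branch_measure K = 1"
    using compact_carrier by blast
  moreover have "c < upper_entropy T branch_measure"
    using a(1) upper_entropy_branch_measure_ge unfolding s(2) by (rule less_le_trans)
  ultimately show ?thesis using branch_measure_in_borel_probs by blast
qed

section \<open>Non-empty compact sets are analytic\<close>

lemma open_cylinder: "open (cylinder q)"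
proof -
  have "cylinder q = {y. \<forall>i\<in>{..<snd q}. y (id i) \<in> {fst q i}}"
    by (auto simp: cylinder_def)
  also have "open \<dots>"
    by (rule product_topology_basis') (auto intro: Topological_Spaces.open_discrete)
  finally show ?thesis .
qed

text \<open>A sequence of indices of a dense sequence \<open>a\<close> is turned into a Cauchy sequence by staying put
  whenever the next point \<open>a (x (i + 1))\<close> is more than \<open>2\<^bsup>-i\<^esup>\<close> away. This makes every
  \<open>x\<close> a code, so that the coding map is defined on all of sequence space.\<close>

primrec guided :: "(nat \<Rightarrow> 'a::metric_space) \<Rightarrow> (nat \<Rightarrow> nat) \<Rightarrow> nat \<Rightarrow> 'a" where
  "guided a x 0 = a (x 0)"
| "guided a x (Suc i) =
    (if dist (a (x (Suc i))) (guided a x i) \<le> (1 / 2) ^ i then a (x (Suc i)) else guided a x i)"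

lemma guided_in_range: "guided a x i \<in> range a"
  by (induction i) auto

lemma guided_cong: "y \<in> cylinder (x, Suc i) \<Longrightarrow> guided a y i = guided a x i"
proof (induction i)
  case (Suc i)
  have "y \<in> cylinder (x, Suc i)" using Suc.prems by (simp add: mem_cylinder)
  then have "guided a y i = guided a x i" by (rule Suc.IH)
  moreover have "y (Suc i) = x (Suc i)" using Suc.prems by (simp add: mem_cylinder)
  ultimately show ?case by simp
qed (simp add: mem_cylinder)

lemma dist_guided_le: "dist (guided a x (i + k)) (guided a x i) \<le> 2 * (1 / 2) ^ i * (1 - (1 / 2) ^ k)"
proof (induction k)
  case (Suc k)
  have "dist (guided a x (i + Suc k)) (guided a x (i + k)) \<le> (1 / 2) ^ (i + k)"
    by simp
  then have "dist (guided a x (i + Suc k)) (guided a x i)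
      \<le> (1 / 2) ^ (i + k) + 2 * (1 / 2) ^ i * (1 - (1 / 2) ^ k)"
    using Suc dist_triangle[of "guided a x (i + Suc k)" "guided a x i" "guided a x (i + k)"] by linarith
  also have "\<dots> = 2 * (1 / 2) ^ i * (1 - (1 / 2) ^ Suc k)"
    by (simp add: power_add algebra_simps)
  finally show ?case .
qed simp

lemma dist_guided_le': "i \<le> m \<Longrightarrow> dist (guided a x m) (guided a x i) \<le> 2 * (1 / 2) ^ i"
proof -
  assume "i \<le> m"
  then obtain k where k: "m = i + k" using le_Suc_ex by blast
  have "2 * (1 / 2 :: real) ^ i * (1 - (1 / 2) ^ k) \<le> 2 * (1 / 2) ^ i * 1"
    by (intro mult_left_mono) auto
  then show ?thesis using dist_guided_le[of a x i k] unfolding k by linarith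
qed

lemma Cauchy_guided: "Cauchy (guided a x)"
proof (rule metric_CauchyI)
  fix e :: real assume "0 < e"
  have "(\<lambda>i. 4 * (1 / 2 :: real) ^ i) \<longlonglongrightarrow> 4 * 0"
    by (intro tendsto_mult tendsto_const LIMSEQ_power_zero) simp
  then have "\<forall>\<^sub>F i in sequentially. 4 * (1 / 2 :: real) ^ i < e"
    by (rule order_tendstoD(2)) (use \<open>0 < e\<close> in simp)
  then obtain i where i: "4 * (1 / 2 :: real) ^ i < e" by (auto simp: eventually_sequentially)
  have "dist (guided a x m) (guided a x n) < e" if "i \<le> m" "i \<le> n" for m n
    using dist_guided_le'[OF that(1), of a x] dist_guided_le'[OF that(2), of a x] i
      dist_triangle2[of "guided a x m" "guided a x n" "guided a x i"] by linarith
  then show "\<exists>M. \<forall>m\<ge>M. \<forall>n\<ge>M. dist (guided a x m) (guided a x n) < e" by blast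
qed

lemma countable_dense_sequence:
  assumes "compact K" "K \<noteq> {}"
  shows "\<exists>a :: nat \<Rightarrow> 'a::metric_space. range a \<subseteq> K \<and> (\<forall>z\<in>K. \<forall>e>0. \<exists>j. dist (a j) z < e)"
proof -
  have "\<forall>e>0. \<exists>F. finite F \<and> F \<subseteq> K \<and> K \<subseteq> (\<Union>x\<in>F. ball x e)"
    using seq_compact_imp_totally_bounded[OF compact_imp_seq_compact[OF assms(1)]] by simp
  then have "\<exists>F. finite F \<and> F \<subseteq> K \<and> K \<subseteq> (\<Union>x\<in>F. ball x (1 / real (Suc n)))" for n
    by simp
  then obtain F where F: "\<And>n. finite (F n)" "\<And>n. F n \<subseteq> K"
    "\<And>n. K \<subseteq> (\<Union>x\<in>F n. ball x (1 / real (Suc n)))" by metis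
  define D where "D = (\<Union>n. F n)"
  have D: "countable D" "D \<subseteq> K" using F(1,2) by (auto simp: D_def countable_finite)
  have dense: "\<exists>x\<in>D. dist x z < e" if z: "z \<in> K" and e: "0 < e" for z e
  proof -
    obtain n where n: "1 / real (Suc n) < e" using nat_approx_posE[OF e] by blast
    obtain x where "x \<in> F n" "dist x z < 1 / real (Suc n)" using F(3)[of n] z by auto
    with n show ?thesis by (intro bexI[of _ x]) (auto simp: D_def)
  qed
  have ne: "D \<noteq> {}" using dense assms(2) zero_less_one by blast
  have "\<exists>j. dist (from_nat_into D j) z < e" if z: "z \<in> K" and e: "0 < e" for z e
  proof -
    obtain x where "x \<in> D" "dist x z < e" using dense[OF z e] by blast
    then show ?thesis using from_nat_into_surj[OF D(1)] by metis
  qed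
  moreover have "range (from_nat_into D) \<subseteq> K"
    using range_from_nat_into[OF ne D(1)] D(2) by simp
  ultimately show ?thesis by blast
qed

text \<open>The coding map \<open>f\<close> sends \<open>x\<close> to the limit of the guided sequence. It is continuous because
  the first \<open>i + 1\<close> entries of \<open>x\<close> determine \<open>f x\<close> up to \<open>4 \<cdot> 2\<^bsup>-i\<^esup>\<close>, and surjective because a
  sequence of sufficiently good approximations to \<open>z\<close> never triggers the waiting rule.\<close>

theorem compact_imp_analytic_set:
  fixes K :: "'a::metric_space set"
  assumes K: "compact K" "K \<noteq> {}"
  shows "analytic_set K"
proof -
  obtain a :: "nat \<Rightarrow> 'a" where a: "range a \<subseteq> K" "\<And>z e. z \<in> K \<Longrightarrow> 0 < e \<Longrightarrow> \<exists>j. dist (a j) z < e"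
    using countable_dense_sequence[OF K] by blast
  have "\<exists>l\<in>K. guided a x \<longlonglongrightarrow> l" for x
  proof -
    have "\<forall>i. guided a x i \<in> K" using guided_in_range a(1) by blast
    then show ?thesis
      using compact_imp_complete[OF K(1)] Cauchy_guided unfolding complete_def by blast
  qed
  then obtain f where f: "\<And>x. f x \<in> K" "\<And>x. guided a x \<longlonglongrightarrow> f x" by metis
  have f_near: "dist (f x) (guided a x i) \<le> 2 * (1 / 2) ^ i" for x i
  proof (rule LIMSEQ_le_const2)
    show "(\<lambda>m. dist (guided a x m) (guided a x i)) \<longlonglongrightarrow> dist (f x) (guided a x i)"
      by (intro tendsto_dist f(2) tendsto_const)
    show "\<exists>N. \<forall>m\<ge>N. dist (guided a x m) (guided a x i) \<le> 2 * (1 / 2) ^ i"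
      using dist_guided_le' by blast
  qed
  have "(f \<longlongrightarrow> f x) (at x)" for x
  proof (rule tendstoI)
    fix e :: real assume "0 < e"
    have "(\<lambda>i. 4 * (1 / 2 :: real) ^ i) \<longlonglongrightarrow> 4 * 0"
      by (intro tendsto_mult tendsto_const LIMSEQ_power_zero) simp
    then have "\<forall>\<^sub>F i in sequentially. 4 * (1 / 2 :: real) ^ i < e"
      by (rule order_tendstoD(2)) (use \<open>0 < e\<close> in simp)
    then obtain i where i: "4 * (1 / 2 :: real) ^ i < e" by (auto simp: eventually_sequentially)
    have "dist (f y) (f x) < e" if "y \<in> cylinder (x, Suc i)" for y
      using f_near[of y i] f_near[of x i] guided_cong[OF that, of a] i
        dist_triangle2[of "f y" "f x" "guided a x i"] by simp
    then show "\<forall>\<^sub>F y in at x. dist (f y) (f x) < e"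
      unfolding eventually_at_topological
      by (intro exI[of _ "cylinder (x, Suc i)"]) (auto simp: open_cylinder mem_cylinder)
  qed
  then have "continuous_on UNIV f" by (simp add: continuous_on_def)
  moreover have "range f = K"
  proof (intro equalityI subsetI)
    fix z assume z: "z \<in> K"
    have "\<exists>j. dist (a j) z < (1 / 2) ^ i / 2" for i by (rule a(2)[OF z]) simp
    then obtain x where x: "\<And>i. dist (a (x i)) z < (1 / 2) ^ i / 2" by metis
    have guided: "guided a x i = a (x i)" for i
    proof (induction i)
      case (Suc i)
      have "dist (a (x (Suc i))) (a (x i)) \<le> dist (a (x (Suc i))) z + dist (a (x i)) z"
        by (rule dist_triangle2)
      also have "\<dots> \<le> (1 / 2) ^ i"
      proof -
        have "0 \<le> (1 / 2 :: real) ^ i" by simp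
        then show ?thesis using x[of i] x[of "Suc i"] unfolding power_Suc by linarith
      qed
      finally show ?case using Suc by simp
    qed simp
    have "(\<lambda>i. dist (a (x i)) z) \<longlonglongrightarrow> 0"
    proof (rule tendsto_sandwich[of "\<lambda>_. 0"])
      have "(\<lambda>i. (1 / 2 :: real) ^ i / 2) \<longlonglongrightarrow> 0 / 2"
        by (intro tendsto_divide tendsto_const LIMSEQ_power_zero) auto
      then show "(\<lambda>i. (1 / 2 :: real) ^ i / 2) \<longlonglongrightarrow> 0" by simp
      show "\<forall>\<^sub>F i in sequentially. dist (a (x i)) z \<le> (1 / 2) ^ i / 2"
        using x by (intro always_eventually allI less_imp_le)
    qed auto
    then have "guided a x \<longlonglongrightarrow> z"
      by (subst tendsto_dist_iff) (simp add: guided)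
    with f(2) have "f x = z" by (rule LIMSEQ_unique)
    then show "z \<in> range f" by blast
  qed (use f(1) in auto)
  ultimately show ?thesis unfolding analytic_set_def by blast
qed

section \<open>The variational principle\<close>

lemma AE_of_measure_one:
  fixes K :: "'a::metric_space set"
  assumes "\<mu> \<in> borel_probs" "compact K" "measure \<mu> K = 1"
  shows "AE x in \<mu>. x \<in> K"
proof -
  interpret prob_space \<mu> using assms(1) by (simp add: borel_probs_def)
  have "K \<in> sets \<mu>"
    using assms(1) borel_closed[OF compact_imp_closed[OF assms(2)]] by (simp add: borel_probs_def)
  then show ?thesis using assms(3) by (simp add: prob_eq_1)
qed

theorem theorem1p3:
  fixes T :: "'a::metric_space \<Rightarrow> 'a"
  assumes "compact (UNIV :: 'a set)" and "continuous_on UNIV T"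
  shows "(\<forall>K. K \<noteq> {} \<and> compact K \<longrightarrow>
            packing_entropy T K = (SUP \<mu>\<in>{\<mu> \<in> borel_probs. measure \<mu> K = 1}. upper_entropy T \<mu>)) \<and>
         (\<forall>Z. analytic_set Z \<longrightarrow>
            packing_entropy T Z = (SUP K\<in>{K. K \<subseteq> Z \<and> compact K}. packing_entropy T K))"
proof (intro conjI allI impI)
  note T = assms(2)
  have large: "\<exists>K \<mu>. K \<subseteq> Z \<and> compact K \<and> \<mu> \<in> borel_probs \<and> measure \<mu> K = 1 \<and> c < upper_entropy T \<mu>"
    if "analytic_set Z" "c < packing_entropy T Z" for Z c
    using that measure_with_large_upper_entropy[OF T] unfolding analytic_set_def by blast
  have upper: "upper_entropy T \<mu> \<le> packing_entropy T K"
    if "\<mu> \<in> borel_probs" "compact K" "measure \<mu> K = 1" for \<mu> K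
    by (rule upper_entropy_le_packing_entropy[OF T that(1) AE_of_measure_one[OF that]])
  {
    fix K :: "'a set" assume K: "K \<noteq> {} \<and> compact K"
    show "packing_entropy T K = (SUP \<mu>\<in>{\<mu> \<in> borel_probs. measure \<mu> K = 1}. upper_entropy T \<mu>)"
    proof (rule antisym)
      show "(SUP \<mu>\<in>{\<mu> \<in> borel_probs. measure \<mu> K = 1}. upper_entropy T \<mu>) \<le> packing_entropy T K"
        using upper K by (intro SUP_least) auto
      show "packing_entropy T K \<le> (SUP \<mu>\<in>{\<mu> \<in> borel_probs. measure \<mu> K = 1}. upper_entropy T \<mu>)"
      proof (rule le_SUP_iff[THEN iffD2], intro allI impI)
        fix c assume "c < packing_entropy T K"
        then obtain L \<mu> where L: "L \<subseteq> K" "compact L" "\<mu> \<in> borel_probs" "measure \<mu> L = 1"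
          "c < upper_entropy T \<mu>"
          using large[OF compact_imp_analytic_set] K by blast
        interpret prob_space \<mu> using L(3) by (simp add: borel_probs_def)
        have "K \<in> sets \<mu>"
          using L(3) K borel_closed[OF compact_imp_closed[of K]] by (simp add: borel_probs_def)
        then have "measure \<mu> L \<le> measure \<mu> K" by (intro finite_measure_mono L(1))
        then have "measure \<mu> K = 1" using L(4) prob_le_1[of K] by linarith
        with L(3,5) show "\<exists>\<mu>\<in>{\<mu> \<in> borel_probs. measure \<mu> K = 1}. c < upper_entropy T \<mu>" by blast
      qed
    qed
  next
    fix Z :: "'a set" assume Z: "analytic_set Z"
    show "packing_entropy T Z = (SUP K\<in>{K. K \<subseteq> Z \<and> compact K}. packing_entropy T K)"
    proof (rule antisym)
      show "(SUP K\<in>{K. K \<subseteq> Z \<and> compact K}. packing_entropy T K) \<le> packing_entropy T Z"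
        by (intro SUP_least packing_entropy_mono) auto
      show "packing_entropy T Z \<le> (SUP K\<in>{K. K \<subseteq> Z \<and> compact K}. packing_entropy T K)"
      proof (rule le_SUP_iff[THEN iffD2], intro allI impI)
        fix c assume "c < packing_entropy T Z"
        then obtain K \<mu> where "K \<subseteq> Z" "compact K" "\<mu> \<in> borel_probs" "measure \<mu> K = 1"
          "c < upper_entropy T \<mu>"
          using large[OF Z] by blast
        then show "\<exists>K\<in>{K. K \<subseteq> Z \<and> compact K}. c < packing_entropy T K"
          using upper less_le_trans by blast
      qed
    qed
  }
qed

end
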